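(* Let $m\ge2$ and $d\ge1$ be integers. The Lie algebra $$\mathfrak{su}C\ell^{\frac1m}_d:=\{U\in C\ell^{\frac1m}_d:\ \overline{U}=-U,\ \langle U\rangle_0=0\}$$ (with the commutator bracket) is the Lie algebra of the Lie group $${\rm SU}C\ell^{\frac1m}_d:=\{U\in C\ell^{\frac1m}_d:\ \overline{U}U=e,\ {\rm Det}(U)=1\},$$ and in the case of even $d$ it is isomorphic to the classical matrix Lie algebra $$\mathfrak{su}C\ell^{\frac1m}_d\simeq\mathfrak{su}(m^{\frac d2}),$$ where $\mathfrak{su}(n)=\{A\in{\rm Mat}(n,\mathbb{C}):A^{\rm H}=-A,\ {\rm tr}(A)=0\}$.
   Context: The generalized Clifford algebra $C\ell^{\frac1m}_d$ is the unital associative algebra over $\mathbb{C}$ with identity $e$ and generators $e_1,\dots,e_d$ subject to $e_j^m=e$ for $j=1,\dots,d$ and $e_ke_l=\omega e_le_k$ for $k<l$, where $\omega:=e^{2\pi i/m}$. It has dimension $m^d$ with basis $e_1^{j_1}\cdots e_d^{j_d}$, $0\le j_1,\dots,j_d\le m-1$ (each basis element is invertible), so each element is uniquely $U=\sum u_{j_1\ldots j_d}e_1^{j_1}\cdots e_d^{j_d}$ with $u_{j_1\ldots j_d}\in\mathbb{C}$. Scalars $c\in\mathbb{C}$ are identified with $ce$, and $\langle U\rangle_0:=u_{0\ldots0}\in\mathbb{C}$. Hermitian conjugation: $\overline{U}:=\sum\overline{u_{j_1\ldots j_d}}\,(e_1^{j_1}\cdots e_d^{j_d})^{-1}$, where $\overline{u}$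 is complex conjugation for $u\in\mathbb{C}$. Determinant: with $N:=m^{[\frac{d+1}{2}]}$ ($[\cdot]$ the integer part), $U_{(1)}:=U$, $C_{(k)}:=\frac Nk\langle U_{(k)}\rangle_0$, $U_{(k+1)}:=U(U_{(k)}-C_{(k)})$, one puts ${\rm Det}(U):=(-1)^{N+1}C_{(N)}\in\mathbb{C}$. Equivalently, ${\rm Det}(U)=\det(\gamma(U))$ for any isomorphism $\gamma$ of unital complex algebras from $C\ell^{\frac1m}_d$ onto ${\rm Mat}(m^{\frac d2},\mathbb{C})$ if $d$ is even, and onto the direct sum of $m$ copies of ${\rm Mat}(m^{\frac{d-1}2},\mathbb{C})$, regarded as block-diagonal matrices of size $m^{\frac{d+1}{2}}$, if $d$ is odd. *)

theory Defs
  imports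
    "HOL-Analysis.Analysis"
    "Berlekamp_Zassenhaus.Finite_Field"
    "Jordan_Normal_Form.Schur_Decomposition"
begin

no_notation Matrix.vec_index (infixl "$" 100)
no_notation Matrix.scalar_prod (infix "\<bullet>" 70)
hide_const (open) VectorSpace.subspace

section \<open>The generalized Clifford algebra\<close>

text \<open>
  The two type parameters encode $m$ and $d$: an integer $m \ge 2$ is \<open>CARD('m)\<close> for \<open>'m\<close> of class
  \<open>nontriv\<close>, which means $1 < $ \<open>CARD('m)\<close>, and $d \ge 1$ is \<open>CARD('d)\<close>; the linear order on \<open>'d\<close>
  is the order of the generators. An element is the family of its coefficients
  $u_{j_1 \ldots j_d}$ in the basis of ordered monomials, the exponents being residues modulo $m$.
\<close>

type_synonym ('m, 'd) expo = "('m mod_ring, 'd) Finite_Cartesian_Product.vec"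

typedef ('m :: nontriv, 'd :: "{finite, linorder}") gca =
  "UNIV :: (complex, ('m, 'd) expo) Finite_Cartesian_Product.vec set"
  morphisms gca_coeffs Gca by simp

setup_lifting type_definition_gca

definition omega :: "'m::nontriv itself \<Rightarrow> complex" where
  "omega _ = exp (2 * of_real pi * \<i> / of_nat CARD('m))"

text \<open>
  Write $e^a$ for the ordered monomial with exponents $a$. Since $e_l e_k = \omega^{-1} e_k e_l$ for
  $k < l$, sorting the product of two monomials gives $e^a e^b =$ \<open>twist a b\<close> $e^{a+b}$.
\<close>

definition twist :: "('m::nontriv, 'd::{finite, linorder}) expo \<Rightarrow> ('m, 'd) expo \<Rightarrow> complex" where
  "twist a b = omega TYPE('m) powi
     (- (\<Sum>l\<in>UNIV. \<Sum>k\<in>{k. k < l}. to_int_mod_ring (a $ l) * to_int_mod_ring (b $ k)))"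

lemma omega_nonzero [simp]: "omega T \<noteq> 0"
  by (simp add: omega_def)

lemma omega_power_card: "omega TYPE('m::nontriv) ^ CARD('m) = 1"
proof -
  have "omega TYPE('m) ^ CARD('m) = exp (of_nat CARD('m) * (2 * of_real pi * \<i> / of_nat CARD('m)))"
    unfolding omega_def by (rule exp_of_nat_mult [symmetric])
  also have "\<dots> = exp (2 * of_real pi * \<i>)"
    using nontriv[where 'a = 'm] by simp
  finally show ?thesis by simp
qed

lemma omega_powi_cong:
  assumes "[x = y] (mod int CARD('m::nontriv))"
  shows "omega TYPE('m) powi x = omega TYPE('m) powi y"
proof -
  from assms obtain k where k: "y = x + int CARD('m) * k"
    by (auto simp: cong_iff_lin)
  have "omega TYPE('m) powi (int CARD('m) * k) = 1"
    by (simp add: power_int_mult omega_power_card)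
  then show ?thesis
    by (simp add: k power_int_add)
qed

lemma cong_to_int_add:
  "[to_int_mod_ring (x + y) = to_int_mod_ring x + to_int_mod_ring y] (mod int CARD('m))"
  for x y :: "'m::nontriv mod_ring"
  by (transfer; simp add: cong_def)

lemma twist_add_left: "twist (a + b) c = twist a c * twist b c"
  for a b c :: "('m::nontriv, 'd::{finite, linorder}) expo"
proof -
  have "omega TYPE('m) powi (- (\<Sum>l\<in>UNIV. \<Sum>k\<in>{k. k < l}.
            to_int_mod_ring ((a + b) $ l) * to_int_mod_ring (c $ k)))
      = omega TYPE('m) powi (- (\<Sum>l\<in>UNIV. \<Sum>k\<in>{k. k < l}.
            (to_int_mod_ring (a $ l) + to_int_mod_ring (b $ l)) * to_int_mod_ring (c $ k)))"
    by (intro omega_powi_cong cong_sum cong_mult cong_refl iffD2 [OF cong_minus_minus_iff])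
       (simp add: cong_to_int_add)
  then show ?thesis
    by (simp add: twist_def ring_distribs sum.distrib flip: power_int_add)
qed

lemma twist_add_right: "twist a (b + c) = twist a b * twist a c"
  for a b c :: "('m::nontriv, 'd::{finite, linorder}) expo"
proof -
  have "omega TYPE('m) powi (- (\<Sum>l\<in>UNIV. \<Sum>k\<in>{k. k < l}.
            to_int_mod_ring (a $ l) * to_int_mod_ring ((b + c) $ k)))
      = omega TYPE('m) powi (- (\<Sum>l\<in>UNIV. \<Sum>k\<in>{k. k < l}.
            to_int_mod_ring (a $ l) * (to_int_mod_ring (b $ k) + to_int_mod_ring (c $ k))))"
    by (intro omega_powi_cong cong_sum cong_mult cong_refl iffD2 [OF cong_minus_minus_iff])
       (simp add: cong_to_int_add)
  then show ?thesis
    by (simp add: twist_def ring_distribs sum.distrib flip: power_int_add)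
qed

lemma twist_zero [simp]: "twist 0 a = 1" "twist a 0 = 1"
  by (simp_all add: twist_def)

instantiation gca :: (nontriv, "{finite, linorder}") real_algebra_1
begin

lift_definition zero_gca :: "('a, 'b) gca" is 0 .
lift_definition one_gca :: "('a, 'b) gca" is "axis 0 1" .
lift_definition plus_gca :: "('a, 'b) gca \<Rightarrow> ('a, 'b) gca \<Rightarrow> ('a, 'b) gca" is "(+)" .
lift_definition minus_gca :: "('a, 'b) gca \<Rightarrow> ('a, 'b) gca \<Rightarrow> ('a, 'b) gca" is "(-)" .
lift_definition uminus_gca :: "('a, 'b) gca \<Rightarrow> ('a, 'b) gca" is "uminus" .
lift_definition scaleR_gca :: "real \<Rightarrow> ('a, 'b) gca \<Rightarrow> ('a, 'b) gca" is "scaleR" .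
lift_definition times_gca :: "('a, 'b) gca \<Rightarrow> ('a, 'b) gca \<Rightarrow> ('a, 'b) gca" is
  "\<lambda>u v. \<chi> c. \<Sum>a\<in>UNIV. u $ a * v $ (c - a) * twist a (c - a)" .

instance
proof
  fix U V W :: "('a, 'b) gca" and r s :: real
  show "U * V * W = U * (V * W)"
  proof (rule gca_coeffs_inject [THEN iffD1], unfold times_gca.rep_eq Finite_Cartesian_Product.vec_eq_iff vec_lambda_beta, rule allI)
    fix c :: "('a, 'b) expo"
    let ?u = "gca_coeffs U" and ?v = "gca_coeffs V" and ?w = "gca_coeffs W"
    have tw: "twist b (a - b) * twist a (c - a) = twist (a - b) (c - a) * twist b (c - b)"
      for a b :: "('a, 'b) expo"
      using twist_add_left[of b "a - b" "c - a"] twist_add_right[of b "a - b" "c - a"] by simp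
    have "(\<Sum>a\<in>UNIV. (\<Sum>b\<in>UNIV. ?u $ b * ?v $ (a - b) * twist b (a - b)) * ?w $ (c - a) * twist a (c - a))
        = (\<Sum>a\<in>UNIV. \<Sum>b\<in>UNIV.
             ?u $ b * (?v $ (a - b) * ?w $ (c - a) * twist (a - b) (c - a)) * twist b (c - b))"
      unfolding sum_distrib_right
    proof (intro sum.cong refl)
      fix a b :: "('a, 'b) expo"
      have "?u $ b * ?v $ (a - b) * twist b (a - b) * ?w $ (c - a) * twist a (c - a)
          = ?u $ b * ?v $ (a - b) * ?w $ (c - a) * (twist b (a - b) * twist a (c - a))" by simp
      then show "?u $ b * ?v $ (a - b) * twist b (a - b) * ?w $ (c - a) * twist a (c - a)
          = ?u $ b * (?v $ (a - b) * ?w $ (c - a) * twist (a - b) (c - a)) * twist b (c - b)"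
        unfolding tw by simp
    qed
    also have "\<dots> = (\<Sum>b\<in>UNIV. \<Sum>a\<in>UNIV.
             ?u $ b * (?v $ (a - b) * ?w $ (c - a) * twist (a - b) (c - a)) * twist b (c - b))"
      by (rule sum.swap)
    also have "\<dots> = (\<Sum>b\<in>UNIV. \<Sum>a\<in>UNIV.
             ?u $ b * (?v $ a * ?w $ (c - b - a) * twist a (c - b - a)) * twist b (c - b))"
    proof (rule sum.cong [OF refl])
      fix b :: "('a, 'b) expo"
      show "(\<Sum>a\<in>UNIV. ?u $ b * (?v $ (a - b) * ?w $ (c - a) * twist (a - b) (c - a)) * twist b (c - b))
          = (\<Sum>a\<in>UNIV. ?u $ b * (?v $ a * ?w $ (c - b - a) * twist a (c - b - a)) * twist b (c - b))"
        by (rule sum.reindex_bij_witness [of _ "\<lambda>a. a + b" "\<lambda>a. a - b"]) (simp_all add: algebra_simps)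
    qed
    finally show "(\<Sum>a\<in>UNIV. (\<Sum>b\<in>UNIV. ?u $ b * ?v $ (a - b) * twist b (a - b)) * ?w $ (c - a) * twist a (c - a))
        = (\<Sum>b\<in>UNIV. ?u $ b * (\<Sum>a\<in>UNIV. ?v $ a * ?w $ (c - b - a) * twist a (c - b - a)) * twist b (c - b))"
      by (simp add: sum_distrib_left sum_distrib_right)
  qed
  show "1 * U = U"
  proof (rule gca_coeffs_inject [THEN iffD1], rule Finite_Cartesian_Product.vec_eq_iff [THEN iffD2], rule allI)
    fix c :: "('a, 'b) expo"
    have "gca_coeffs (1 * U) $ c = (\<Sum>a\<in>(UNIV :: ('a, 'b) expo set). if a = 0 then gca_coeffs U $ c else 0)"
      unfolding times_gca.rep_eq one_gca.rep_eq vec_lambda_beta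
      by (rule sum.cong [OF refl]) (auto simp: axis_def)
    then show "gca_coeffs (1 * U) $ c = gca_coeffs U $ c" by simp
  qed
  show "U * 1 = U"
  proof (rule gca_coeffs_inject [THEN iffD1], rule Finite_Cartesian_Product.vec_eq_iff [THEN iffD2], rule allI)
    fix c :: "('a, 'b) expo"
    have "gca_coeffs (U * 1) $ c = (\<Sum>a\<in>UNIV. if a = c then gca_coeffs U $ c else 0)"
      unfolding times_gca.rep_eq one_gca.rep_eq vec_lambda_beta
      by (rule sum.cong [OF refl]) (auto simp: axis_def)
    then show "gca_coeffs (U * 1) $ c = gca_coeffs U $ c" by simp
  qed
  show "(U + V) * W = U * W + V * W" "U * (V + W) = U * V + U * W"
    by (transfer; simp add: Finite_Cartesian_Product.vec_eq_iff algebra_simps sum.distrib)+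
  show "(r *\<^sub>R U) * V = r *\<^sub>R (U * V)" "U * (r *\<^sub>R V) = r *\<^sub>R (U * V)"
    by (transfer; simp add: Finite_Cartesian_Product.vec_eq_iff scaleR_sum_right)+
  show "(0::('a, 'b) gca) \<noteq> 1"
    by transfer (simp add: Finite_Cartesian_Product.vec_eq_iff axis_def exI [of _ 0])
qed (transfer; simp add: algebra_simps; fail)+

end

instantiation gca :: (nontriv, "{finite, linorder}") euclidean_space
begin

lift_definition inner_gca :: "('a, 'b) gca \<Rightarrow> ('a, 'b) gca \<Rightarrow> real" is "(\<bullet>)" .
lift_definition norm_gca :: "('a, 'b) gca \<Rightarrow> real" is norm .
lift_definition sgn_gca :: "('a, 'b) gca \<Rightarrow> ('a, 'b) gca" is sgn .
lift_definition dist_gca :: "('a, 'b) gca \<Rightarrow> ('a, 'b) gca \<Rightarrow> real" is dist .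
lift_definition Basis_gca :: "('a, 'b) gca set" is Basis .
definition uniformity_gca :: "(('a, 'b) gca \<times> ('a, 'b) gca) filter" where
  "uniformity_gca = (INF e\<in>{0<..}. principal {(x, y). dist x y < e})"
definition open_gca :: "('a, 'b) gca set \<Rightarrow> bool" where
  "open_gca S = (\<forall>x\<in>S. \<forall>\<^sub>F (x', y) in uniformity. x' = x \<longrightarrow> y \<in> S)"

instance
proof
  fix U V W :: "('a, 'b) gca" and r :: real
  show "dist U V = norm (U - V)" by transfer (rule dist_norm)
  show "sgn U = U /\<^sub>R norm U" by transfer (rule sgn_div_norm)
  show "U \<bullet> V = V \<bullet> U" by transfer (rule inner_commute)
  show "(U + V) \<bullet> W = U \<bullet> W + V \<bullet> W" by transfer (rule inner_add_left)
  show "(r *\<^sub>R U) \<bullet> V = r * (U \<bullet> V)" by transfer simp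
  show "0 \<le> U \<bullet> U" by transfer simp
  show "(U \<bullet> U = 0) = (U = 0)" by transfer simp
  show "norm U = sqrt (U \<bullet> U)" by transfer (rule norm_eq_sqrt_inner)
  show "(Basis :: ('a, 'b) gca set) \<noteq> {}" "finite (Basis :: ('a, 'b) gca set)"
    by (transfer; simp)+
  show "(\<forall>u\<in>Basis. U \<bullet> u = 0) = (U = 0)"
    by transfer (rule euclidean_all_zero_iff)
  show "U \<in> Basis \<Longrightarrow> V \<in> Basis \<Longrightarrow> U \<bullet> V = (if U = V then 1 else 0)"
    by transfer (rule inner_Basis)
qed (rule uniformity_gca_def open_gca_def)+

end

lift_definition cscale :: "complex \<Rightarrow> ('m::nontriv, 'd::{finite, linorder}) gca \<Rightarrow> ('m, 'd) gca"
  is "(*s)" .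

definition gen :: "'d::{finite, linorder} \<Rightarrow> ('m::nontriv, 'd) gca" where
  "gen k = Gca (axis (axis k 1) 1)"

definition gmon :: "('m::nontriv, 'd::{finite, linorder}) expo \<Rightarrow> ('m, 'd) gca" where
  "gmon j = prod_list (map (\<lambda>k. gen k ^ nat (to_int_mod_ring (j $ k))) (sorted_list_of_set UNIV))"

subsection \<open>Adequacy of the model\<close>

text \<open>
  The generators satisfy the defining relations, and the coefficients of an element are its
  coordinates in the ordered monomials, which are a basis. The relations alone already reduce every
  word in the generators to a multiple of an ordered monomial, so no further relation holds.
\<close>

lemma cscale_algebra:
  fixes U V :: "('m::nontriv, 'd::{finite, linorder}) gca"
  shows "cscale 1 U = U" "cscale (a * b) U = cscale a (cscale b U)"
    "cscale (a + b) U = cscale a U + cscale b U" "cscale a (U + V) = cscale a U + cscale a V"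
    "cscale a U * V = cscale a (U * V)" "U * cscale a V = cscale a (U * V)"
    "cscale (of_real r) U = r *\<^sub>R U"
proof -
  show "cscale 1 U = U" "cscale (a * b) U = cscale a (cscale b U)"
    "cscale (a + b) U = cscale a U + cscale b U" "cscale a (U + V) = cscale a U + cscale a V"
    by (transfer, simp add: vector_smult_assoc vector_sadd_rdistrib vector_add_ldistrib)+
  show "cscale (of_real r) U = r *\<^sub>R U"
    by (transfer, simp add: Finite_Cartesian_Product.vec_eq_iff scaleR_conv_of_real [where 'a = complex])
  show "cscale a U * V = cscale a (U * V)" "U * cscale a V = cscale a (U * V)"
    by (rule gca_coeffs_inject [THEN iffD1], rule Finite_Cartesian_Product.vec_eq_iff [THEN iffD2],
        simp add: times_gca.rep_eq cscale.rep_eq sum_distrib_left mult.assoc mult.left_commute [of _ a])+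
qed

lemma Gca_axis_mult:
  "Gca (axis a 1) * Gca (axis b 1) = cscale (twist a b) (Gca (axis (a + b) 1))"
  for a b :: "('m::nontriv, 'd::{finite, linorder}) expo"
proof -
  have "(\<Sum>x\<in>UNIV. axis a 1 $ x * axis b 1 $ (c - x) * twist x (c - x))
      = twist a b * axis (a + b) 1 $ c" for c
  proof -
    have "(\<Sum>x\<in>UNIV. axis a 1 $ x * axis b 1 $ (c - x) * twist x (c - x))
        = (\<Sum>x\<in>UNIV. if x = a then axis b 1 $ (c - a) * twist a (c - a) else 0)"
      by (rule sum.cong [OF refl]) (auto simp: axis_def)
    also have "\<dots> = axis b 1 $ (c - a) * twist a (c - a)"
      by simp
    also have "\<dots> = twist a b * axis (a + b) 1 $ c"
    proof (cases "c = a + b")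
      case False
      then have "c - a \<noteq> b" by (metis add.commute diff_add_cancel)
      with False show ?thesis unfolding axis_def vec_lambda_beta by (simp only: if_False mult_zero_left mult_zero_right)
    qed (simp add: axis_def)
    finally show ?thesis .
  qed
  then have "gca_coeffs (Gca (axis a 1) * Gca (axis b 1)) $ c
      = gca_coeffs (cscale (twist a b) (Gca (axis (a + b) 1))) $ c" for c
    by (simp add: times_gca.rep_eq cscale.rep_eq Gca_inverse)
  then show ?thesis
    by (metis gca_coeffs_inject Finite_Cartesian_Product.vec_eq_iff)
qed

lemma twist_axis_right:
  "twist a (axis k y) = omega TYPE('m) powi
     (- (\<Sum>l\<in>{l. k < l}. to_int_mod_ring (a $ l) * to_int_mod_ring y))"
  for a :: "('m::nontriv, 'd::{finite, linorder}) expo"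
proof -
  have "(\<Sum>i\<in>{i. i < l}. to_int_mod_ring (a $ l) * to_int_mod_ring (axis k y $ i))
      = (if k < l then to_int_mod_ring (a $ l) * to_int_mod_ring y else 0)" for l
  proof -
    have "(\<Sum>i\<in>{i. i < l}. to_int_mod_ring (a $ l) * to_int_mod_ring (axis k y $ i))
        = (\<Sum>i\<in>{i. i < l}. if i = k then to_int_mod_ring (a $ l) * to_int_mod_ring y else 0)"
      by (rule sum.cong [OF refl]) (auto simp: axis_def)
    then show ?thesis by simp
  qed
  then show ?thesis
    by (simp add: twist_def sum.If_cases Collect_conv_if)
qed

lemma twist_axis:
  "twist (axis k x) (axis l y) =
     (if l < k then omega TYPE('m) powi (- (to_int_mod_ring x * to_int_mod_ring y)) else 1)"
  for x y :: "'m::nontriv mod_ring" and k l :: "'d::{finite, linorder}"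
proof -
  have "(\<Sum>i\<in>{i. l < i}. to_int_mod_ring (axis k x $ i) * to_int_mod_ring y)
      = (\<Sum>i\<in>{i. l < i}. if i = k then to_int_mod_ring x * to_int_mod_ring y else 0)"
    by (rule sum.cong [OF refl]) (auto simp: axis_def)
  then show ?thesis
    by (simp add: twist_axis_right)
qed

lemma axis_add: "axis k x + axis k y = axis k (x + y)"
  for x y :: "'a::monoid_add"
  by (simp add: Finite_Cartesian_Product.vec_eq_iff axis_def)

lemma gen_power: "(gen k :: ('m::nontriv, 'd::{finite, linorder}) gca) ^ n
    = Gca (axis (axis k (of_nat n)) 1)"
proof (induction n)
  case 0
  have "axis k 0 = (0 :: ('m, 'd) expo)" by simp
  then show ?case unfolding one_gca_def by (simp only: power_0 of_nat_0 one_gca_def)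
next
  case (Suc n)
  then show ?case
    by (simp add: gen_def Gca_axis_mult twist_axis axis_add cscale_algebra)
qed

lemma gen_power_card: "(gen k :: ('m::nontriv, 'd::{finite, linorder}) gca) ^ CARD('m) = 1"
  using gen_power [of k 0, where 'm = 'm] by (simp add: gen_power)

lemma gen_commute:
  assumes "k < l"
  shows "(gen k :: ('m::nontriv, 'd::{finite, linorder}) gca) * gen l
    = cscale (omega TYPE('m)) (gen l * gen k)"
proof -
  from assms have "\<not> l < k" by simp
  with assms show ?thesis
    by (simp add: gen_def Gca_axis_mult twist_axis cscale_algebra(1) add.commute [of "axis l 1"]
        flip: cscale_algebra(2))
qed

lemma gmon_eq: "gmon j = Gca (axis j 1)"
  for j :: "('m::nontriv, 'd::{finite, linorder}) expo"
proof -
  have "prod_list (map (\<lambda>k. gen k ^ nat (to_int_mod_ring (j $ k))) ks)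
      = Gca (axis (\<Sum>k\<in>set ks. axis k (j $ k)) 1)"
    if "sorted ks" "distinct ks" for ks :: "'d list"
    using that
  proof (induction ks rule: rev_induct)
    case Nil
    then show ?case by (simp add: one_gca_def)
  next
    case (snoc l ks)
    let ?a = "\<Sum>k\<in>set ks. axis k (j $ k)"
    have pow: "gen l ^ nat (to_int_mod_ring (j $ l)) = Gca (axis (axis l (j $ l)) 1)"
    proof -
      have "to_int_mod_ring (j $ l) \<ge> 0"
        using range_to_int_mod_ring [where 'a = 'm] by (metis atLeastLessThan_iff rangeI)
      then have "of_nat (nat (to_int_mod_ring (j $ l))) = j $ l"
        by (simp add: of_nat_of_int_mod_ring)
      then show ?thesis by (simp add: gen_power)
    qed
    have "?a $ i = 0" if "l < i" for i
      using snoc.prems that by (auto simp: sum_component axis_def sorted_append intro!: sum.neutral)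
    then have "twist ?a (axis l (j $ l)) = 1"
      by (simp add: twist_axis_right)
    moreover have "?a + axis l (j $ l) = (\<Sum>k\<in>set (ks @ [l]). axis k (j $ k))"
      using snoc.prems by (simp add: add.commute)
    ultimately show ?case
      using snoc by (simp add: sorted_append pow Gca_axis_mult cscale_algebra add.commute [of "axis l (j $ l)"])
  qed
  from this [of "sorted_list_of_set UNIV"]
  have "gmon j = Gca (axis (\<Sum>k\<in>UNIV. axis k (j $ k)) 1)"
    by (simp add: gmon_def)
  also have "(\<Sum>k\<in>UNIV. axis k (j $ k)) = j"
    by (simp add: Finite_Cartesian_Product.vec_eq_iff sum_component axis_def if_distrib cong: if_cong)
  finally show ?thesis .
qed

lemma gca_expansion: "U = (\<Sum>j\<in>UNIV. cscale (c j) (gmon j)) \<longleftrightarrow> (\<forall>j. c j = gca_coeffs U $ j)"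
  for U :: "('m::nontriv, 'd::{finite, linorder}) gca"
proof -
  have "gca_coeffs (sum f A) = (\<Sum>j\<in>A. gca_coeffs (f j))"
    for f :: "('m, 'd) expo \<Rightarrow> ('m, 'd) gca" and A
    by (induction A rule: infinite_finite_induct) (simp_all add: zero_gca.rep_eq plus_gca.rep_eq)
  then have "gca_coeffs (\<Sum>j\<in>UNIV. cscale (c j) (gmon j)) $ i = c i" for i
    by (simp add: gmon_eq cscale.rep_eq Gca_inverse sum_component axis_def if_distrib cong: if_cong)
  then show ?thesis
    unfolding gca_coeffs_inject [symmetric] Finite_Cartesian_Product.vec_eq_iff by auto
qed

section \<open>Hermitian conjugation, determinant, and the two sets\<close>

definition alg_inverse :: "'a::monoid_mult \<Rightarrow> 'a" where
  "alg_inverse x = (THE y. x * y = 1 \<and> y * x = 1)"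

text \<open>Every ordered monomial is invertible, so \<open>alg_inverse\<close> is well defined where it is used.\<close>

lemma gmon_alg_inverse:
  "gmon j * alg_inverse (gmon j) = 1 \<and> alg_inverse (gmon j) * gmon j = 1"
  for j :: "('m::nontriv, 'd::{finite, linorder}) expo"
proof -
  define V where "V = cscale (1 / twist j (- j)) (gmon (- j))"
  have nz: "twist j (- j) \<noteq> 0" by (simp add: twist_def)
  have "twist j j * twist (- j) j = 1" "twist j j * twist j (- j) = 1"
    using twist_add_left [of j "- j" j] twist_add_right [of j j "- j"] by simp_all
  then have "twist (- j) j = twist j (- j)"
    by (metis mult_cancel_left mult_zero_left zero_neq_one)
  have one: "cscale (1 / t) (cscale t (Gca (axis 0 1))) = 1" if "t \<noteq> 0" for t
    using that unfolding cscale_algebra(2) [symmetric] one_gca_def by (simp add: cscale_algebra(1))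
  have V: "gmon j * V = 1" "V * gmon j = 1"
    unfolding V_def gmon_eq cscale_algebra(5,6) Gca_axis_mult \<open>twist (- j) j = twist j (- j)\<close>
    by (simp_all only: right_minus left_minus one [OF nz])
  have uniq: "y = V" if "gmon j * y = 1 \<and> y * gmon j = 1" for y
  proof -
    have "y = (V * gmon j) * y" using V by simp
    also have "\<dots> = V" using that by (simp add: mult.assoc)
    finally show ?thesis .
  qed
  have "alg_inverse (gmon j) = V"
    unfolding alg_inverse_def by (rule the_equality, rule conjI [OF V], erule uniq)
  with V show ?thesis by (simp only: simp_thms)
qed

definition hconj :: "('m::nontriv, 'd::{finite, linorder}) gca \<Rightarrow> ('m, 'd) gca" where
  "hconj U = (\<Sum>j\<in>UNIV. cscale (cnj (gca_coeffs U $ j)) (alg_inverse (gmon j)))"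

definition scalar_part :: "('m::nontriv, 'd::{finite, linorder}) gca \<Rightarrow> complex" where
  "scalar_part U = gca_coeffs U $ 0"

definition det_size :: "('m::nontriv, 'd::{finite, linorder}) gca itself \<Rightarrow> nat" where
  "det_size _ = CARD('m) ^ ((CARD('d) + 1) div 2)"

text \<open>\<open>det_iter U k\<close> is $U_{(k)}$ and \<open>det_coeff U k\<close> is $C_{(k)}$; the value at \<open>k = 0\<close> is unused.\<close>

fun det_iter :: "('m::nontriv, 'd::{finite, linorder}) gca \<Rightarrow> nat \<Rightarrow> ('m, 'd) gca" where
  "det_iter U 0 = 0"
| "det_iter U (Suc 0) = U"
| "det_iter U (Suc (Suc k)) = U * (det_iter U (Suc k) -
     cscale (of_nat (det_size TYPE(('m, 'd) gca)) / of_nat (Suc k) * scalar_part (det_iter U (Suc k))) 1)"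

definition det_coeff :: "('m::nontriv, 'd::{finite, linorder}) gca \<Rightarrow> nat \<Rightarrow> complex" where
  "det_coeff U k = of_nat (det_size TYPE(('m, 'd) gca)) / of_nat k * scalar_part (det_iter U k)"

definition gdet :: "('m::nontriv, 'd::{finite, linorder}) gca \<Rightarrow> complex" where
  "gdet U = (- 1) ^ (det_size TYPE(('m, 'd) gca) + 1) * det_coeff U (det_size TYPE(('m, 'd) gca))"

definition su_gca :: "('m::nontriv, 'd::{finite, linorder}) gca set" where
  "su_gca = {U. hconj U = - U \<and> scalar_part U = 0}"

definition SU_gca :: "('m::nontriv, 'd::{finite, linorder}) gca set" where
  "SU_gca = {U. hconj U * U = 1 \<and> gdet U = 1}"

section \<open>Lie groups of invertible elements and their Lie algebras\<close>

text \<open>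
  \<open>Ck_on k S f\<close>, for open \<open>S\<close> and a finite-dimensional domain, says that \<open>f\<close> is $C^k$ on \<open>S\<close>: it is
  differentiable and all its directional derivatives \<open>\<lambda>x. f' x v\<close> are $C^{k-1}$.
\<close>

primrec Ck_on :: "nat \<Rightarrow> 'a::real_normed_vector set \<Rightarrow> ('a \<Rightarrow> 'b::real_normed_vector) \<Rightarrow> bool" where
  "Ck_on 0 S f \<longleftrightarrow> continuous_on S f"
| "Ck_on (Suc k) S f \<longleftrightarrow> (\<exists>f'. (\<forall>x\<in>S. (f has_derivative f' x) (at x)) \<and> (\<forall>v. Ck_on k S (\<lambda>x. f' x v)))"

definition smooth_on :: "'a::real_normed_vector set \<Rightarrow> ('a \<Rightarrow> 'b::real_normed_vector) \<Rightarrow> bool" where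
  "smooth_on S f \<longleftrightarrow> (\<forall>k. Ck_on k S f)"

text \<open>
  Embedded submanifolds of dimension \<open>n\<close>, given locally as regular zero sets. The defining map
  \<open>F\<close> takes its values in a subspace \<open>T\<close> of the ambient space, whose dimension is the codimension
  of \<open>M\<close>; this avoids a separate target type and is no restriction.
\<close>

definition smooth_submanifold :: "nat \<Rightarrow> 'a::euclidean_space set \<Rightarrow> bool" where
  "smooth_submanifold n M \<longleftrightarrow> (\<forall>p\<in>M. \<exists>W T (F :: 'a \<Rightarrow> 'a).
     open W \<and> p \<in> W \<and> subspace T \<and> dim T + n = DIM('a) \<and>
     smooth_on W F \<and> F ` W \<subseteq> T \<and> M \<inter> W = {x \<in> W. F x = 0} \<and>
     (\<forall>x\<in>M \<inter> W. \<exists>F'. (F has_derivative F') (at x) \<and> range F' = T))"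

definition tangent_space :: "'a::euclidean_space set \<Rightarrow> 'a \<Rightarrow> 'a set" where
  "tangent_space M p = {X. \<exists>\<gamma> \<epsilon>. \<epsilon> > 0 \<and> smooth_on {- \<epsilon> <..< \<epsilon>} \<gamma> \<and> \<gamma> ` {- \<epsilon> <..< \<epsilon>} \<subseteq> M \<and>
     \<gamma> 0 = p \<and> (\<gamma> has_vector_derivative X) (at (0::real))}"

text \<open>
  A Lie group here is an embedded Lie subgroup of the open group of units of a finite-dimensional
  real algebra. Multiplication and inversion are smooth on the group of units, hence on \<open>G\<close>.
\<close>

definition Lie_group :: "'a::{real_algebra_1, euclidean_space} set \<Rightarrow> bool" where
  "Lie_group G \<longleftrightarrow>
     1 \<in> G \<and> (\<forall>x\<in>G. \<forall>y\<in>G. x * y \<in> G) \<and> (\<forall>x\<in>G. \<exists>y\<in>G. x * y = 1 \<and> y * x = 1) \<and>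
     (\<exists>n. smooth_submanifold n G)"

definition Lie_algebra :: "'a::real_vector set \<Rightarrow> ('a \<Rightarrow> 'a \<Rightarrow> 'a) \<Rightarrow> bool" where
  "Lie_algebra L br \<longleftrightarrow> subspace L \<and>
     (\<forall>x\<in>L. \<forall>y\<in>L. br x y \<in> L) \<and>
     (\<forall>x\<in>L. \<forall>y\<in>L. \<forall>z\<in>L. \<forall>a b. br (a *\<^sub>R x + b *\<^sub>R y) z = a *\<^sub>R br x z + b *\<^sub>R br y z \<and>
        br z (a *\<^sub>R x + b *\<^sub>R y) = a *\<^sub>R br z x + b *\<^sub>R br z y) \<and>
     (\<forall>x\<in>L. br x x = 0) \<and>
     (\<forall>x\<in>L. \<forall>y\<in>L. \<forall>z\<in>L. br x (br y z) + br y (br z x) + br z (br x y) = 0)"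

definition vector_field_bracket ::
    "('a::real_normed_vector \<Rightarrow> 'a) \<Rightarrow> ('a \<Rightarrow> 'a) \<Rightarrow> 'a \<Rightarrow> 'a" where
  "vector_field_bracket V W p = frechet_derivative W (at p) (V p) - frechet_derivative V (at p) (W p)"

text \<open>
  The Lie algebra of \<open>G\<close> is its tangent space at the identity, with the bracket of left-invariant
  vector fields. The left-invariant field on \<open>G\<close> with value \<open>X\<close> at the identity is the restriction
  of \<open>\<lambda>U. U * X\<close>, so its brackets may be computed in the ambient space.
\<close>

definition Lie_algebra_of :: "'a::{real_algebra_1, euclidean_space} set \<Rightarrow> ('a \<Rightarrow> 'a \<Rightarrow> 'a) \<Rightarrow> 'a set \<Rightarrow> bool" where
  "Lie_algebra_of L br G \<longleftrightarrow> L = tangent_space G 1 \<and>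
     (\<forall>X\<in>L. \<forall>Y\<in>L. br X Y = vector_field_bracket (\<lambda>U. U * X) (\<lambda>U. U * Y) 1)"

definition commutator :: "'a::ring \<Rightarrow> 'a \<Rightarrow> 'a" where
  "commutator X Y = X * Y - Y * X"

section \<open>The matrix Lie algebra\<close>

definition su_mat :: "nat \<Rightarrow> complex mat set" where
  "su_mat n = {A \<in> carrier_mat n n. mat_adjoint A = - A \<and> (\<Sum>i<n. A $$ (i, i)) = 0}"

text \<open>
  Isomorphism of real Lie algebras, for the commutator brackets; matrices of all sizes form
  a single type, which is therefore not a ring.
\<close>

definition Lie_isomorphic_mat :: "'a::real_algebra_1 set \<Rightarrow> complex mat set \<Rightarrow> bool" where
  "Lie_isomorphic_mat L K \<longleftrightarrow> (\<exists>f. bij_betw f L K \<and>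
     (\<forall>X\<in>L. \<forall>Y\<in>L. f (X + Y) = f X + f Y) \<and>
     (\<forall>X\<in>L. \<forall>r. f (r *\<^sub>R X) = of_real r \<cdot>\<^sub>m f X) \<and>
     (\<forall>X\<in>L. \<forall>Y\<in>L. f (commutator X Y) = f X * f Y - f Y * f X))"

end

theory Submission
  imports Defs
begin

text \<open>
  The algebra has a faithful *-representation $\gamma$ of dimension $N = m^{[(d+1)/2]}$ with
  ${\rm tr}\,\gamma(U) = N \langle U\rangle_0$, induced from a character of a commutative
  subalgebra spanned by monomials. For even $d$ it is onto, which is the isomorphism with
  $\mathfrak{su}(m^{d/2})$. The recursion for the determinant is Newton's recursion between the
  power sums and the elementary symmetric functions of the eigenvalues of $\gamma(U)$, so
  ${\rm Det} = \det \circ \gamma$ is multiplicative, and at an invertible $U$ its derivative is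
  $H \mapsto {\rm Det}(U)\, N \langle U^{-1} H\rangle_0$. The equations of the group are therefore
  regular and its tangent space at the identity is contained in the kernel of their linearization;
  the curves $\exp(tX)$ give the other inclusion.
\<close>

section \<open>Coefficients, conjugation and scalar part\<close>

text \<open>Everything is governed by the commutation factor \<open>twist a b / twist b a\<close> of
  two monomials. No two distinct generators commute, so the generators themselves do not fall into
  independent pairs. But with positions counted from 0, the inverse of generator 2k times generator
  2k+1 commutes with every generator outside its pair; these products therefore commute with each
  other and generate the commutative subalgebra, while the generators at even positions supply the
  complement. For odd d the last generator remains unpaired and goes to the complement. This is the
  origin of the exponent [(d+1)/2] and lets one construction serve both parities, without forming
  the direct sum of m blocks. For odd d the representation is not onto, so its faithfulness is not a
  matter of counting dimensions: it follows from the trace formula and the positivity of the scalar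
  part of \<open>hconj U * U\<close>.\<close>

lemma gca_eqI: "(\<And>j. gca_coeffs U $ j = gca_coeffs V $ j) \<Longrightarrow> U = V"
  by (metis gca_coeffs_inject Finite_Cartesian_Product.vec_eq_iff)

lemma gca_coeffs_simps [simp]:
  "gca_coeffs 0 $ j = 0"
  "gca_coeffs (U + V) $ j = gca_coeffs U $ j + gca_coeffs V $ j"
  "gca_coeffs (U - V) $ j = gca_coeffs U $ j - gca_coeffs V $ j"
  "gca_coeffs (- U) $ j = - gca_coeffs U $ j"
  "gca_coeffs (r *\<^sub>R U) $ j = r *\<^sub>R gca_coeffs U $ j"
  "gca_coeffs (cscale c U) $ j = c * gca_coeffs U $ j"
  by (simp_all add: zero_gca.rep_eq plus_gca.rep_eq minus_gca.rep_eq uminus_gca.rep_eq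
      scaleR_gca.rep_eq cscale.rep_eq)

lemma gca_coeffs_one: "gca_coeffs 1 $ j = (if j = 0 then 1 else 0)"
  by (simp add: one_gca.rep_eq axis_def)

lemma gca_coeffs_gmon: "gca_coeffs (gmon a) $ j = (if j = a then 1 else 0)"
  by (simp add: gmon_eq Gca_inverse axis_def)

lemma gca_coeffs_sum: "gca_coeffs (sum f S) $ j = (\<Sum>x\<in>S. gca_coeffs (f x) $ j)"
  by (induction S rule: infinite_finite_induct) simp_all

lemma gca_coeffs_mult:
  "gca_coeffs (U * V) $ c = (\<Sum>a\<in>UNIV. gca_coeffs U $ a * gca_coeffs V $ (c - a) * twist a (c - a))"
  by (simp add: times_gca.rep_eq)

lemma gmon_mult: "gmon a * gmon b = cscale (twist a b) (gmon (a + b))"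
  by (simp add: gmon_eq Gca_axis_mult)

lemma gmon_zero: "gmon 0 = 1"
  by (rule gca_eqI) (simp add: gca_coeffs_gmon gca_coeffs_one)

lemma gca_eq_sum_gmon: "U = (\<Sum>j\<in>UNIV. cscale (gca_coeffs U $ j) (gmon j))"
  by (rule gca_expansion [THEN iffD2]) simp

lemma cscale_one_mult: "cscale c 1 * U = cscale c U" "U * cscale c 1 = cscale c U"
  by (simp_all add: cscale_algebra)

section \<open>The bicharacter \<open>twist\<close>\<close>

lemma norm_omega: "cmod (omega T) = 1"
  by (simp add: omega_def)

lemma norm_twist: "cmod (twist a b) = 1"
  by (simp add: twist_def norm_omega norm_power_int)

lemma twist_nonzero [simp]: "twist a b \<noteq> 0"
  using norm_twist[of a b] by force

lemma cnj_unimodular: "cmod z = 1 \<Longrightarrow> cnj z = inverse z"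
  by (simp add: inverse_complex_def complex_eq_iff cmod_power2 [symmetric])

lemma cnj_twist: "cnj (twist a b) = inverse (twist a b)"
  by (simp add: cnj_unimodular norm_twist)

lemma twist_minus_left: "twist (- a) b = inverse (twist a b)"
  using twist_add_left[of a "- a" b] by (simp add: inverse_unique)

lemma twist_minus_right: "twist a (- b) = inverse (twist a b)"
  using twist_add_right[of a b "- b"] by (simp add: inverse_unique)

lemma twist_diff_left: "twist (a - b) c = twist a c / twist b c"
  using twist_add_left[of a "- b" c] by (simp add: twist_minus_left divide_inverse)

lemma twist_diff_right: "twist a (b - c) = twist a b / twist a c"
  using twist_add_right[of a b "- c"] by (simp add: twist_minus_right divide_inverse)

text \<open>Used as rewrite rules, these reduce identities between monomials to arithmetic with
  nonzero complex numbers.\<close>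

lemmas twist_bichar = twist_add_left twist_add_right twist_minus_left twist_minus_right
  twist_diff_left twist_diff_right

text \<open>The product \<open>gmon j * gmon (- j)\<close> is the scalar
  \<open>twist j (- j)\<close>, which is the inverse of \<open>twist j j\<close>. Checking one side
  suffices because \<open>gmon j\<close> is known to be invertible.\<close>

lemma alg_inverse_gmon: "alg_inverse (gmon j) = cscale (twist j j) (gmon (- j))"
proof -
  let ?V = "cscale (twist j j) (gmon (- j))"
  have "gmon j * ?V = 1"
    by (simp add: cscale_algebra(6) gmon_mult twist_bichar gmon_zero flip: cscale_algebra(2))
       (simp add: cscale_algebra)
  then have "alg_inverse (gmon j) = alg_inverse (gmon j) * (gmon j * ?V)"
    by simp
  also have "\<dots> = ?V"
    using gmon_alg_inverse [of j] by (simp flip: mult.assoc)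
  finally show ?thesis .
qed

text \<open>Only the inverse of the monomial with exponent \<open>- j\<close> contributes at
  \<open>j\<close>, and its scalar \<open>twist (- j) (- j)\<close> equals
  \<open>twist j j\<close>.\<close>

lemma hconj_coeff: "gca_coeffs (hconj U) $ j = cnj (gca_coeffs U $ (- j)) * twist j j"
proof -
  have "gca_coeffs (hconj U) $ j
      = (\<Sum>a\<in>UNIV. if a = - j then cnj (gca_coeffs U $ (- j)) * twist j j else 0)"
    unfolding hconj_def gca_coeffs_sum alg_inverse_gmon gca_coeffs_simps gca_coeffs_gmon
    by (rule sum.cong [OF refl]) (auto simp: twist_bichar)
  then show ?thesis by simp
qed

lemma hconj_add: "hconj (U + V) = hconj U + hconj V"
  and hconj_diff: "hconj (U - V) = hconj U - hconj V"
  and hconj_zero: "hconj 0 = 0"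
  and hconj_scaleR: "hconj (r *\<^sub>R U) = r *\<^sub>R hconj U"
  and hconj_cscale: "hconj (cscale c U) = cscale (cnj c) (hconj U)"
  and hconj_one: "hconj 1 = 1"
  and hconj_hconj: "hconj (hconj U) = U"
  by (rule gca_eqI; simp add: hconj_coeff gca_coeffs_one algebra_simps cnj_twist twist_bichar)+

lemma hconj_mult: "hconj (U * V) = hconj V * hconj U"
proof (rule gca_eqI)
  fix c
  let ?u = "gca_coeffs U" and ?v = "gca_coeffs V"
  have "gca_coeffs (hconj (U * V)) $ c
      = (\<Sum>a\<in>UNIV. cnj (?u $ a) * cnj (?v $ (- c - a)) * inverse (twist a (- c - a)) * twist c c)"
    by (simp add: hconj_coeff gca_coeffs_mult cnj_twist sum_distrib_right)
  \<comment> \<open>Substituting \<open>b = a + c\<close> moves the argument of the coefficient of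
    \<open>V\<close> to \<open>- b\<close>, where \<open>hconj V\<close> at \<open>b\<close> reads
    it.\<close>
  also have "\<dots> = (\<Sum>b\<in>UNIV. cnj (?u $ (b - c)) * cnj (?v $ (- b))
      * inverse (twist (b - c) (- b)) * twist c c)"
    by (rule sum.reindex_bij_witness [of _ "\<lambda>b. b - c" "\<lambda>a. a + c"]) (simp_all add: minus_diff_commute)
  also have "\<dots> = gca_coeffs (hconj V * hconj U) $ c"
    unfolding gca_coeffs_mult hconj_coeff
    by (rule sum.cong [OF refl]) (simp add: twist_bichar field_simps)
  finally show "gca_coeffs (hconj (U * V)) $ c = gca_coeffs (hconj V * hconj U) $ c" .
qed

lemma hconj_gmon_mult: "hconj (gmon a) * gmon a = 1"
proof -
  have "hconj (gmon a) = alg_inverse (gmon a)"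
    by (rule gca_eqI) (auto simp: hconj_coeff gca_coeffs_gmon alg_inverse_gmon twist_bichar)
  then show ?thesis
    using gmon_alg_inverse [of a] by simp
qed

section \<open>The scalar part as a positive trace\<close>

lemma scalar_part_simps [simp]:
  "scalar_part 0 = 0"
  "scalar_part 1 = 1"
  "scalar_part (U + V) = scalar_part U + scalar_part V"
  "scalar_part (U - V) = scalar_part U - scalar_part V"
  "scalar_part (- U) = - scalar_part U"
  "scalar_part (r *\<^sub>R U) = r *\<^sub>R scalar_part U"
  "scalar_part (cscale c U) = c * scalar_part U"
  by (simp_all add: scalar_part_def gca_coeffs_one)

lemma scalar_part_sum: "scalar_part (sum f S) = (\<Sum>x\<in>S. scalar_part (f x))"
  by (simp add: scalar_part_def gca_coeffs_sum)

lemma scalar_part_hconj: "scalar_part (hconj U) = cnj (scalar_part U)"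
  by (simp add: scalar_part_def hconj_coeff)

text \<open>Only pairs of monomials with opposite exponents contribute, and such monomials
  commute.\<close>

lemma scalar_part_mult_commute: "scalar_part (U * V) = scalar_part (V * U)"
proof -
  have "scalar_part (U * V)
      = (\<Sum>a\<in>UNIV. gca_coeffs U $ a * gca_coeffs V $ (- a) * twist a (- a))"
    by (simp add: scalar_part_def gca_coeffs_mult)
  also have "\<dots> = (\<Sum>a\<in>UNIV. gca_coeffs V $ a * gca_coeffs U $ (- a) * twist a (- a))"
    by (rule sum.reindex_bij_witness [of _ uminus uminus]) (simp_all add: twist_bichar)
  also have "\<dots> = scalar_part (V * U)"
    by (simp add: scalar_part_def gca_coeffs_mult)
  finally show ?thesis .
qed

text \<open>The monomials are unitary, and the product of the inverse of one with a different one
  has no scalar part, so they are orthonormal for this pairing.\<close>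

lemma scalar_part_hconj_mult:
  "scalar_part (hconj U * U) = of_real (\<Sum>a\<in>UNIV. (cmod (gca_coeffs U $ a))\<^sup>2)"
proof -
  have "scalar_part (hconj U * U)
      = (\<Sum>a\<in>UNIV. cnj (gca_coeffs U $ (- a)) * twist a a * gca_coeffs U $ (- a) * twist a (- a))"
    by (simp add: scalar_part_def gca_coeffs_mult hconj_coeff)
  also have "\<dots> = (\<Sum>a\<in>UNIV. of_real ((cmod (gca_coeffs U $ (- a)))\<^sup>2))"
    by (rule sum.cong [OF refl]) (simp add: twist_bichar complex_norm_square [symmetric] field_simps)
  also have "\<dots> = (\<Sum>a\<in>UNIV. of_real ((cmod (gca_coeffs U $ a))\<^sup>2))"
    by (rule sum.reindex_bij_witness [of _ uminus uminus]) simp_all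
  finally show ?thesis by simp
qed

lemma gca_eq_0_if_scalar_part:
  assumes "scalar_part (hconj U * U) = 0"
  shows "U = 0"
proof -
  have "(\<Sum>a\<in>UNIV. (cmod (gca_coeffs U $ a))\<^sup>2) = 0"
    using assms unfolding scalar_part_hconj_mult by (simp only: of_real_eq_0_iff)
  then have "gca_coeffs U $ a = 0" for a
    by (simp add: sum_nonneg_eq_0_iff)
  then show ?thesis
    by (intro gca_eqI) simp
qed

lemma bounded_linear_hconj: "bounded_linear (hconj :: ('m::nontriv, 'd::{finite, linorder}) gca \<Rightarrow> _)"
  by (rule linear_conv_bounded_linear [THEN iffD1], rule linearI) (simp_all add: hconj_add hconj_scaleR)

lemma bounded_linear_scalar_part:
  "bounded_linear (scalar_part :: ('m::nontriv, 'd::{finite, linorder}) gca \<Rightarrow> _)"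
  by (rule linear_conv_bounded_linear [THEN iffD1], rule linearI) simp_all

lemma bounded_linear_cscale:
  "bounded_linear (\<lambda>c. cscale c (U :: ('m::nontriv, 'd::{finite, linorder}) gca))"
  by (rule linear_conv_bounded_linear [THEN iffD1], rule linearI)
     (simp_all add: cscale_algebra(2,3,7) scaleR_conv_of_real [of _ "_ :: complex"])

section \<open>Induced representations\<close>

text \<open>Translation by \<open>y\<close> permutes \<open>H\<close> and multiplies the sum by
  \<open>f y\<close>.\<close>

lemma character_sum_eq_0:
  fixes f :: "'a::ab_group_add \<Rightarrow> complex"
  assumes "\<And>x. x \<in> H \<Longrightarrow> x + y \<in> H" "\<And>x. x \<in> H \<Longrightarrow> x - y \<in> H"
    and "\<And>x. x \<in> H \<Longrightarrow> f (x + y) = f x * f y" and "f y \<noteq> 1"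
  shows "sum f H = 0"
proof -
  have "sum f H = (\<Sum>x\<in>H. f (x + y))"
    by (rule sum.reindex_bij_witness [of _ "\<lambda>x. x + y" "\<lambda>x. x - y"]) (simp_all add: assms)
  also have "\<dots> = sum f H * f y"
    by (simp add: assms sum_distrib_right)
  finally show ?thesis
    using assms(4) by simp
qed

text \<open>Conjugation leaves only the commutation factor. For fixed \<open>a\<close> this factor
  is a character in \<open>r\<close>, which is what makes the off-scalar terms of the trace
  cancel.\<close>

lemma gmon_conj: "hconj (gmon r) * gmon a * gmon r = cscale (twist a r / twist r a) (gmon a)"
proof -
  have "gmon a * gmon r = cscale (twist a r / twist r a) (gmon r * gmon a)"
    by (simp add: gmon_mult add.commute flip: cscale_algebra(2))
  then show ?thesis
    by (simp add: mult.assoc cscale_algebra(6)) (simp add: hconj_gmon_mult flip: mult.assoc)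
qed

text \<open>
  Here \<open>L\<close> and \<open>R\<close> are complementary subgroups of exponents, and \<open>chi\<close> makes
  $e^l \mapsto \chi(l)$ a one-dimensional representation of the commutative subalgebra spanned by the
  $e^l$, $l \in L$. Its extension by $0$ is the functional \<open>phi\<close>, and $\varphi((e^r)^{-1} U e^s)$,
  for $r, s \in R$, are the entries of $U$ in the induced representation, with basis
  $e^s \otimes 1$.
\<close>

locale gca_splitting =
  fixes L R :: "('m::nontriv, 'd::{finite, linorder}) expo set"
    and chi :: "('m, 'd) expo \<Rightarrow> complex"
    and N :: nat and idx :: "nat \<Rightarrow> ('m, 'd) expo"
  assumes L_zero: "0 \<in> L" and L_add: "a \<in> L \<Longrightarrow> b \<in> L \<Longrightarrow> a + b \<in> L" and L_minus: "a \<in> L \<Longrightarrow> - a \<in> L"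
    and R_zero: "0 \<in> R" and R_add: "a \<in> R \<Longrightarrow> b \<in> R \<Longrightarrow> a + b \<in> R" and R_minus: "a \<in> R \<Longrightarrow> - a \<in> R"
    and L_Int_R: "a \<in> L \<Longrightarrow> a \<in> R \<Longrightarrow> a = 0"
    and decomp: "\<exists>r\<in>R. \<exists>l\<in>L. a = r + l"
    and chi_mult: "a \<in> L \<Longrightarrow> b \<in> L \<Longrightarrow> chi a * chi b = twist a b * chi (a + b)"
    and norm_chi: "a \<in> L \<Longrightarrow> cmod (chi a) = 1"
    and nondegenerate_L: "a \<in> L \<Longrightarrow> a \<noteq> 0 \<Longrightarrow> \<exists>r\<in>R. twist a r \<noteq> twist r a"
    and idx: "bij_betw idx {..<N} R"
begin

lemma L_diff: "a \<in> L \<Longrightarrow> b \<in> L \<Longrightarrow> a - b \<in> L"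
  using L_add [of a "- b"] by (simp add: L_minus)

lemma R_diff: "a \<in> R \<Longrightarrow> b \<in> R \<Longrightarrow> a - b \<in> R"
  using R_add [of a "- b"] by (simp add: R_minus)

lemma chi_zero: "chi 0 = 1"
  using chi_mult [OF L_zero L_zero] norm_chi [OF L_zero] by (auto simp: mult_cancel_right1)

lemma chi_nonzero: "a \<in> L \<Longrightarrow> chi a \<noteq> 0"
  using norm_chi by force

lemma add_in_L_iff: "l \<in> L \<Longrightarrow> a + l \<in> L \<longleftrightarrow> a \<in> L"
  using L_add [of a l] L_diff [of "a + l" l] by auto

definition phi :: "('m, 'd) gca \<Rightarrow> complex" where
  "phi U = (\<Sum>l\<in>L. gca_coeffs U $ l * chi l)"

lemma phi_simps [simp]:
  "phi 0 = 0" "phi (U + V) = phi U + phi V" "phi (cscale c U) = c * phi U"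
  "phi (- U) = - phi U" "phi (U - V) = phi U - phi V"
  by (simp_all add: phi_def algebra_simps sum.distrib sum_distrib_left sum_subtractf sum_negf)

lemma phi_sum: "phi (sum f S) = (\<Sum>x\<in>S. phi (f x))"
  by (induction S rule: infinite_finite_induct) simp_all

lemma phi_gmon: "phi (gmon a) = (if a \<in> L then chi a else 0)"
  by (simp add: phi_def gca_coeffs_gmon if_distrib [of "\<lambda>x. x * _"] cong: if_cong)

lemma phi_expand: "phi (U * V * W) = (\<Sum>a\<in>UNIV. gca_coeffs V $ a * phi (U * gmon a * W))"
proof -
  have "phi (U * V * W) = phi (U * (\<Sum>a\<in>UNIV. cscale (gca_coeffs V $ a) (gmon a)) * W)"
    by (simp flip: gca_eq_sum_gmon)
  then show ?thesis
    by (simp add: sum_distrib_left sum_distrib_right phi_sum cscale_algebra)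
qed

text \<open>The scalar from \<open>gmon_mult\<close> is exactly the one in \<open>chi_mult\<close>,
  and translation by \<open>l\<close> preserves membership in \<open>L\<close>. This is the right
  linearity over the commutative subalgebra that defines the induced module.\<close>

lemma phi_mult_gmon:
  assumes "l \<in> L"
  shows "phi (U * gmon l) = phi U * chi l"
proof -
  have "phi (gmon a * gmon l) = phi (gmon a) * chi l" for a
    using assms by (simp add: gmon_mult phi_gmon add_in_L_iff chi_mult)
  then show ?thesis
    using phi_expand [of 1 U "gmon l"] phi_expand [of 1 U 1] by (simp add: sum_distrib_right mult.assoc)
qed

text \<open>For distinct \<open>r\<close> and \<open>s\<close> the product is a multiple of the
  monomial with exponent \<open>s - r\<close>, which lies in \<open>R\<close> and hence outside
  \<open>L\<close>.\<close>

lemma phi_gmon_R: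
  assumes "r \<in> R" "s \<in> R"
  shows "phi (hconj (gmon r) * gmon s) = (if r = s then 1 else 0)"
proof (cases "r = s")
  case True
  then show ?thesis
    using phi_gmon [of 0] by (simp add: hconj_gmon_mult gmon_zero L_zero chi_zero)
next
  case False
  have "hconj (gmon r) = cscale (twist r r) (gmon (- r))"
    by (rule gca_eqI) (auto simp: hconj_coeff gca_coeffs_gmon twist_bichar)
  moreover have "s - r \<notin> L"
    using False L_Int_R [of "s - r"] R_diff assms by auto
  ultimately show ?thesis
    using False by (simp add: cscale_algebra gmon_mult phi_gmon)
qed

lemma finite_R: "finite R"
  and finite_L: "finite L"
  by simp_all

text \<open>Completeness of the basis indexed by \<open>R\<close>, the identity behind
  multiplicativity of the matrices. A monomial is a scalar times a factor from \<open>R\<close>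
  followed by one from \<open>L\<close>; the latter is pulled out by \<open>phi_mult_gmon\<close>,
  and one \<open>r\<close> survives.\<close>

lemma phi_split: "(\<Sum>r\<in>R. phi (W * gmon r) * phi (hconj (gmon r) * Y)) = phi (W * Y)"
proof -
  have base: "(\<Sum>r\<in>R. phi (W * gmon r) * phi (hconj (gmon r) * gmon b)) = phi (W * gmon b)" for b
  proof -
    obtain s l where s: "s \<in> R" and l: "l \<in> L" and b: "b = s + l"
      using decomp by blast
    have gb: "gmon b = cscale (inverse (twist s l)) (gmon s * gmon l)"
      by (simp add: b gmon_mult cscale_algebra(1) flip: cscale_algebra(2))
    have "(\<Sum>r\<in>R. phi (W * gmon r) * phi (hconj (gmon r) * gmon b))
        = (\<Sum>r\<in>R. if r = s then phi (W * gmon s) * chi l * inverse (twist s l) else 0)"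
      using s l by (intro sum.cong refl)
        (simp add: gb cscale_algebra(6) phi_mult_gmon phi_gmon_R flip: mult.assoc)
    also have "\<dots> = phi (W * gmon b)"
      using s l finite_R by (simp add: gb cscale_algebra(6) phi_mult_gmon flip: mult.assoc)
    finally show ?thesis .
  qed
  have "(\<Sum>r\<in>R. phi (W * gmon r) * phi (hconj (gmon r) * Y))
      = (\<Sum>r\<in>R. \<Sum>b\<in>UNIV. gca_coeffs Y $ b * (phi (W * gmon r) * phi (hconj (gmon r) * gmon b)))"
    using phi_expand [of _ Y 1] by (simp add: sum_distrib_left mult_ac)
  also have "\<dots> = (\<Sum>b\<in>UNIV. gca_coeffs Y $ b * phi (W * gmon b))"
    by (subst sum.swap) (simp add: base flip: sum_distrib_left)
  also have "\<dots> = phi (W * Y)"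
    using phi_expand [of W Y 1] by simp
  finally show ?thesis .
qed

text \<open>Since \<open>chi\<close> is unimodular, \<open>cnj (chi l)\<close> is the inverse of
  \<open>chi l\<close>, and \<open>chi_mult\<close> at \<open>- l\<close> and \<open>l\<close>
  identifies it with \<open>twist l l * chi (- l)\<close>. This makes the representation compatible
  with adjoints.\<close>

lemma phi_hconj: "phi (hconj U) = cnj (phi U)"
proof -
  have "phi (hconj U) = (\<Sum>l\<in>L. cnj (gca_coeffs U $ (- l)) * twist l l * chi l)"
    by (simp add: phi_def hconj_coeff)
  also have "\<dots> = (\<Sum>l\<in>L. cnj (gca_coeffs U $ l) * (twist l l * chi (- l)))"
    by (rule sum.reindex_bij_witness [of _ uminus uminus]) (simp_all add: L_minus twist_bichar)
  also have "\<dots> = (\<Sum>l\<in>L. cnj (gca_coeffs U $ l) * cnj (chi l))"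
  proof (intro sum.cong refl)
    fix l assume l: "l \<in> L"
    then have "chi (- l) * chi l = inverse (twist l l)"
      by (simp add: chi_mult L_minus twist_bichar chi_zero)
    then have "twist l l * chi (- l) = inverse (chi l)"
      using chi_nonzero [OF l] by (simp add: field_simps)
    then show "cnj (gca_coeffs U $ l) * (twist l l * chi (- l)) = cnj (gca_coeffs U $ l) * cnj (chi l)"
      using l by (simp add: norm_chi cnj_unimodular)
  qed
  finally show ?thesis
    by (simp add: phi_def)
qed

section \<open>The matrices of the induced representation\<close>

definition rep :: "('m, 'd) gca \<Rightarrow> complex mat" where
  "rep U = mat N N (\<lambda>(i, j). phi (hconj (gmon (idx i)) * U * gmon (idx j)))"

lemma rep_carrier [simp]: "rep U \<in> carrier_mat N N"
  and dim_rep [simp]: "dim_row (rep U) = N" "dim_col (rep U) = N"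
  by (simp_all add: rep_def)

lemma rep_index: "i < N \<Longrightarrow> j < N \<Longrightarrow> rep U $$ (i, j) = phi (hconj (gmon (idx i)) * U * gmon (idx j))"
  by (simp add: rep_def)

lemma idx_mem: "i < N \<Longrightarrow> idx i \<in> R"
  using idx by (auto simp: bij_betw_def)

lemma idx_eq_iff: "i < N \<Longrightarrow> j < N \<Longrightarrow> idx i = idx j \<longleftrightarrow> i = j"
  using idx by (auto simp: bij_betw_def inj_on_def)

lemma sum_idx: "(\<Sum>i<N. f (idx i)) = sum f R"
  by (rule sum.reindex_bij_betw [OF idx])

lemma N_pos: "N > 0"
  using idx R_zero by (auto simp: bij_betw_def)

lemma rep_one: "rep 1 = 1\<^sub>m N"
  by (rule eq_matI) (auto simp: rep_index phi_gmon_R idx_mem idx_eq_iff)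

lemma rep_add: "rep (U + V) = rep U + rep V"
  by (rule eq_matI) (auto simp: rep_index algebra_simps)

lemma rep_diff: "rep (U - V) = rep U - rep V"
  by (rule eq_matI) (auto simp: rep_index algebra_simps)

lemma rep_uminus: "rep (- U) = - rep U"
  by (rule eq_matI) (auto simp: rep_index)

lemma rep_cscale: "rep (cscale c U) = c \<cdot>\<^sub>m rep U"
  by (rule eq_matI) (auto simp: rep_index cscale_algebra)

lemma rep_mult: "rep (U * V) = rep U * rep V"
proof (rule eq_matI)
  fix i j assume "i < dim_row (rep U * rep V)" "j < dim_col (rep U * rep V)"
  then have i: "i < N" and j: "j < N" by simp_all
  have "(rep U * rep V) $$ (i, j) = (\<Sum>k<N. rep U $$ (i, k) * rep V $$ (k, j))"
    using i j by (simp add: scalar_prod_def atLeast0LessThan)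
  also have "\<dots> = (\<Sum>k<N. phi (hconj (gmon (idx i)) * U * gmon (idx k))
      * phi (hconj (gmon (idx k)) * (V * gmon (idx j))))"
    using i j by (simp add: rep_index mult.assoc)
  also have "\<dots> = phi (hconj (gmon (idx i)) * U * (V * gmon (idx j)))"
    by (subst phi_split [symmetric]) (rule sum_idx)
  also have "\<dots> = rep (U * V) $$ (i, j)"
    using i j by (simp add: rep_index mult.assoc)
  finally show "rep (U * V) $$ (i, j) = (rep U * rep V) $$ (i, j)" by simp
qed simp_all

lemma rep_hconj: "rep (hconj U) = mat_adjoint (rep U)"
proof (rule eq_matI)
  fix i j assume "i < dim_row (mat_adjoint (rep U))" "j < dim_col (mat_adjoint (rep U))"
  then have ij: "i < N" "j < N" by (simp_all add: mat_adjoint_def)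
  have "phi (hconj (gmon (idx i)) * hconj U * gmon (idx j))
      = phi (hconj (hconj (gmon (idx j)) * U * gmon (idx i)))"
    by (simp add: hconj_mult hconj_hconj mult.assoc)
  with ij show "rep (hconj U) $$ (i, j) = mat_adjoint (rep U) $$ (i, j)"
    by (simp add: rep_index mat_adjoint_def mat_of_rows_index phi_hconj)
qed (simp_all add: mat_adjoint_def)

text \<open>On a monomial outside \<open>L\<close> every diagonal entry vanishes. On a nontrivial
  one in \<open>L\<close> the entries are multiples of a character of \<open>R\<close>, nontrivial
  by \<open>nondegenerate_L\<close>, and cancel. Only the identity is left.\<close>

lemma trace_rep: "(\<Sum>i<N. rep U $$ (i, i)) = of_nat N * scalar_part U"
proof -
  have char: "(\<Sum>r\<in>R. phi (hconj (gmon r) * gmon a * gmon r)) = (if a = 0 then of_nat N else 0)" for a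
  proof (cases "a \<in> L \<and> a \<noteq> 0")
    case True
    then obtain s where s: "s \<in> R" "twist a s \<noteq> twist s a"
      using nondegenerate_L by blast
    have "(\<Sum>r\<in>R. twist a r / twist r a) = 0"
      by (rule character_sum_eq_0 [of _ s]) (use s in \<open>simp_all add: R_add R_diff twist_bichar\<close>)
    with True show ?thesis
      by (simp add: gmon_conj phi_gmon del: times_divide_eq_left flip: sum_distrib_right)
  next
    case False
    then show ?thesis
      using L_zero bij_betw_same_card [OF idx] by (auto simp: gmon_conj phi_gmon chi_zero)
  qed
  have "(\<Sum>i<N. rep U $$ (i, i)) = (\<Sum>r\<in>R. phi (hconj (gmon r) * U * gmon r))"
    using sum_idx [of "\<lambda>r. phi (hconj (gmon r) * U * gmon r)"] by (simp add: rep_index)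
  also have "\<dots> = (\<Sum>a\<in>UNIV. gca_coeffs U $ a * (\<Sum>r\<in>R. phi (hconj (gmon r) * gmon a * gmon r)))"
    by (subst phi_expand, subst sum.swap) (simp add: sum_distrib_left)
  also have "\<dots> = of_nat N * scalar_part U"
    unfolding char by (simp add: scalar_part_def if_distrib cong: if_cong)
  finally show ?thesis .
qed

text \<open>If \<open>rep U\<close> vanishes, so does the trace of \<open>hconj U * U\<close>, which
  is \<open>N\<close> times a sum of squares.\<close>

lemma rep_eq_0D:
  assumes "rep U = 0\<^sub>m N N"
  shows "U = 0"
proof (rule gca_eq_0_if_scalar_part)
  have "rep (hconj U * U) = 0\<^sub>m N N"
    unfolding rep_mult assms by (rule right_mult_zero_mat) simp
  then have "of_nat N * scalar_part (hconj U * U) = (\<Sum>i<N. 0\<^sub>m N N $$ (i, i))"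
    by (simp flip: trace_rep)
  then show "scalar_part (hconj U * U) = 0"
    using N_pos by simp
qed

lemma rep_inject: "rep U = rep V \<longleftrightarrow> U = V"
proof
  assume "rep U = rep V"
  then have "rep (U - V) = 0\<^sub>m N N"
    unfolding rep_diff by (intro eq_matI) auto
  then show "U = V"
    using rep_eq_0D by fastforce
qed simp

text \<open>The extra hypothesis says that no nontrivial monomial from \<open>R\<close> commutes
  with all of \<open>L\<close>. An unpaired last generator would be such a monomial.\<close>

lemma rep_surj:
  assumes nondegenerate_R: "\<And>r. r \<in> R \<Longrightarrow> r \<noteq> 0 \<Longrightarrow> \<exists>l\<in>L. twist l r \<noteq> twist r l"
    and M: "M \<in> carrier_mat N N"
  shows "\<exists>U. rep U = M"
proof -
  \<comment> \<open>the idempotent of \<open>chi\<close>; the $e^r P (e^s)^{-1}$ are the matrix units\<close>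
  define P where "P = (\<Sum>l\<in>L. cscale (cnj (chi l) / of_nat (card L)) (gmon l))"
  have card_L: "card L > 0"
    using L_zero finite_L by (auto simp: card_gt_0_iff)
  have phi_P: "phi (hconj (gmon s) * P * gmon r) = (if r = 0 \<and> s = 0 then 1 else 0)"
    if rs: "r \<in> R" "s \<in> R" for r s
  proof -
    have comm: "gmon l * gmon r = cscale (twist l r / twist r l) (gmon r * gmon l)" for l
      by (simp add: gmon_mult add.commute flip: cscale_algebra(2))
    have "phi (hconj (gmon s) * P * gmon r)
        = (\<Sum>l\<in>L. cnj (chi l) / of_nat (card L) * phi (hconj (gmon s) * (gmon l * gmon r)))"
      by (simp add: P_def sum_distrib_left sum_distrib_right phi_sum cscale_algebra mult.assoc)
    also have "\<dots> = (\<Sum>l\<in>L. (if s = r then 1 / of_nat (card L) else 0) * (twist l r / twist r l))"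
    proof (intro sum.cong refl)
      fix l assume l: "l \<in> L"
      have "cnj (chi l) * chi l = 1"
        using norm_chi [OF l] chi_nonzero [OF l] by (simp add: cnj_unimodular)
      moreover have "phi (hconj (gmon s) * (gmon l * gmon r))
          = twist l r / twist r l * ((if s = r then 1 else 0) * chi l)"
        unfolding comm cscale_algebra using rs l
        by (simp add: phi_mult_gmon phi_gmon_R flip: mult.assoc)
      ultimately show "cnj (chi l) / of_nat (card L) * phi (hconj (gmon s) * (gmon l * gmon r))
          = (if s = r then 1 / of_nat (card L) else 0) * (twist l r / twist r l)"
        by (simp add: field_simps)
    qed
    also have "\<dots> = (if s = r then 1 / of_nat (card L) else 0) * (\<Sum>l\<in>L. twist l r / twist r l)"
      by (simp add: sum_distrib_left)
    \<comment> \<open>Averaging over \<open>L\<close> is now a character sum in \<open>l\<close>,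
      and \<open>nondegenerate_R\<close> makes the character nontrivial unless \<open>r = 0\<close>.
      So \<open>P\<close> becomes the matrix unit at the index 0.\<close>
    also have "(\<Sum>l\<in>L. twist l r / twist r l) = (if r = 0 then of_nat (card L) else 0)"
    proof (cases "r = 0")
      case False
      then obtain l where l: "l \<in> L" "twist l r \<noteq> twist r l"
        using nondegenerate_R rs by blast
      have "(\<Sum>l\<in>L. twist l r / twist r l) = 0"
        by (rule character_sum_eq_0 [of _ l]) (use l in \<open>simp_all add: L_add L_diff twist_bichar\<close>)
      with False show ?thesis by simp
    qed simp
    finally show ?thesis
      using card_L by auto
  qed
  define E where "E r s = gmon r * P * hconj (gmon s)" for r s
  have phi_E: "phi (hconj (gmon p) * E r s * gmon q) = (if p = r \<and> s = q then 1 else 0)"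
    if "p \<in> R" "q \<in> R" "r \<in> R" "s \<in> R" for p q r s
  proof -
    let ?W = "hconj (gmon p) * gmon r" and ?Z = "hconj (gmon s) * gmon q"
    have P: "phi (hconj (gmon u) * (P * ?Z)) = (if u = 0 then phi ?Z else 0)" if u: "u \<in> R" for u
    proof -
      have "phi (hconj (gmon u) * (P * ?Z))
          = (\<Sum>v\<in>R. phi (hconj (gmon u) * P * gmon v) * phi (hconj (gmon v) * ?Z))"
        using phi_split [of "hconj (gmon u) * P" ?Z] by (simp add: mult.assoc)
      also have "\<dots> = (\<Sum>v\<in>R. if v = 0 then (if u = 0 then phi ?Z else 0) else 0)"
        using u by (intro sum.cong refl) (simp add: phi_P gmon_zero hconj_one)
      finally show ?thesis
        using R_zero finite_R by simp
    qed
    have "phi (hconj (gmon p) * E r s * gmon q) = phi (?W * (P * ?Z))"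
      by (simp add: E_def mult.assoc)
    \<comment> \<open>\<open>phi_split\<close> inserts the basis between \<open>?W\<close> and
      \<open>P\<close>; since \<open>P\<close> is the matrix unit at 0, only \<open>u = 0\<close>
      remains.\<close>
    also have "\<dots> = (\<Sum>u\<in>R. phi (?W * gmon u) * phi (hconj (gmon u) * (P * ?Z)))"
      by (simp add: phi_split)
    also have "\<dots> = (\<Sum>u\<in>R. if u = 0 then phi ?W * phi ?Z else 0)"
      by (intro sum.cong refl) (simp add: P gmon_zero)
    finally show ?thesis
      using R_zero finite_R that by (simp add: phi_gmon_R)
  qed
  define U where "U = (\<Sum>i<N. \<Sum>j<N. cscale (M $$ (i, j)) (E (idx i) (idx j)))"
  have "rep U = M"
  proof (rule eq_matI)
    fix p q assume "p < dim_row M" "q < dim_col M"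
    with M have pq: "p < N" "q < N" by auto
    have "rep U $$ (p, q) = (\<Sum>i<N. \<Sum>j<N. M $$ (i, j) *
        phi (hconj (gmon (idx p)) * E (idx i) (idx j) * gmon (idx q)))"
      using pq by (simp add: rep_index U_def sum_distrib_left sum_distrib_right phi_sum cscale_algebra)
    also have "\<dots> = (\<Sum>i<N. \<Sum>j<N. if i = p then (if j = q then M $$ (p, q) else 0) else 0)"
      using pq by (intro sum.cong refl) (auto simp: phi_E idx_mem idx_eq_iff)
    also have "\<dots> = M $$ (p, q)"
      using pq by (simp add: sum.If_cases)
    finally show "rep U $$ (p, q) = M $$ (p, q)" .
  qed (use M in auto)
  then show ?thesis ..
qed

end

section \<open>An isotropic subgroup and a complement\<close>

definition ring_char :: "'m::nontriv mod_ring \<Rightarrow> complex" where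
  "ring_char x = omega TYPE('m) powi to_int_mod_ring x"

lemma ring_char_of_int: "ring_char (of_int n :: 'm::nontriv mod_ring) = omega TYPE('m) powi n"
  unfolding ring_char_def
  by (rule omega_powi_cong)
     (simp add: cong_def of_int_of_int_mod_ring of_int_mod_ring.rep_eq to_int_mod_ring.rep_eq)

lemma of_int_to_int_mod_ring: "of_int (to_int_mod_ring x) = x"
  by (simp add: of_int_of_int_mod_ring)

lemma ring_char_add: "ring_char (x + y) = ring_char x * ring_char y"
  using ring_char_of_int [of "to_int_mod_ring x + to_int_mod_ring y", where 'm = 'a]
  by (simp add: of_int_to_int_mod_ring ring_char_def power_int_add)

lemma ring_char_zero [simp]: "ring_char 0 = 1"
  by (simp add: ring_char_def)

lemma ring_char_sum: "ring_char (sum f S) = (\<Prod>x\<in>S. ring_char (f x))"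
  by (induction S rule: infinite_finite_induct) (simp_all add: ring_char_add)

text \<open>\<open>omega\<close> is a primitive m-th root of unity. Through this, showing that a
  value of \<open>twist\<close> differs from 1 becomes a computation with residues.\<close>

lemma ring_char_eq_1_iff: "ring_char x = 1 \<longleftrightarrow> x = 0" for x :: "'m::nontriv mod_ring"
proof
  assume *: "ring_char x = 1"
  define n where "n = nat (to_int_mod_ring x)"
  have range: "to_int_mod_ring x \<in> {0..<int CARD('m)}"
    using range_to_int_mod_ring [where 'a = 'm] by (metis rangeI)
  then have n: "to_int_mod_ring x = int n" "n < CARD('m)"
    by (auto simp: n_def)
  have "ring_char x = exp (2 * of_real pi * \<i> * of_nat n / of_nat CARD('m))"
    by (simp add: ring_char_def n omega_def exp_of_nat_mult [symmetric] mult_ac)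
  with * have "CARD('m) dvd n"
    using complex_root_unity_eq_1 [of "CARD('m)" n] by simp
  with n have "n = 0"
    by (meson dvd_imp_le gr0I not_le)
  with n show "x = 0"
    using of_int_to_int_mod_ring [of x] by simp
qed simp

text \<open>
  An exponent $a$ is handled through its coordinates along the increasing enumeration of the
  generators, extended by $0$; this extension makes the pairing of the positions $2k$ and $2k+1$
  uniform in the parity of $d$.
\<close>

definition nth_gen :: "nat \<Rightarrow> 'd::{finite, linorder}" where
  "nth_gen i = sorted_list_of_set UNIV ! i"

lemma nth_gen_less_iff:
  assumes "i < CARD('d)" "j < CARD('d)"
  shows "nth_gen i < (nth_gen j :: 'd::{finite, linorder}) \<longleftrightarrow> i < j"
proof -
  have *: "nth_gen i < (nth_gen j :: 'd)" if "i < j" "j < CARD('d)" for i j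
    using that strict_sorted_list_of_set [of "UNIV :: 'd set"]
    by (simp add: nth_gen_def sorted_wrt_nth_less)
  show ?thesis
    using * [of i j] * [of j i] assms by (metis linorder_neqE_nat not_less_iff_gr_or_eq)
qed

lemma bij_nth_gen: "bij_betw nth_gen {..<CARD('d)} (UNIV :: 'd::{finite, linorder} set)"
  unfolding bij_betw_def
proof
  show "inj_on (nth_gen :: nat \<Rightarrow> 'd) {..<CARD('d)}"
  proof (rule linorder_inj_onI')
    fix i j assume "i \<in> {..<CARD('d)}" "j \<in> {..<CARD('d)}" "i < j"
    then have "nth_gen i < (nth_gen j :: 'd)"
      by (simp add: nth_gen_less_iff)
    then show "nth_gen i \<noteq> (nth_gen j :: 'd)" by simp
  qed
  show "nth_gen ` {..<CARD('d)} = (UNIV :: 'd set)"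
    using nth_image [of "CARD('d)" "sorted_list_of_set (UNIV :: 'd set)"]
    by (simp add: nth_gen_def [abs_def] atLeast0LessThan)
qed

lemma nth_gen_surj:
  obtains i where "i < CARD('d)" "nth_gen i = (k :: 'd::{finite, linorder})"
  using bij_betw_imp_surj_on [OF bij_nth_gen] by (metis UNIV_I imageE lessThan_iff)

definition coord :: "('m::nontriv, 'd::{finite, linorder}) expo \<Rightarrow> nat \<Rightarrow> 'm mod_ring" where
  "coord a i = (if i < CARD('d) then a $ nth_gen i else 0)"

lemma coord_ge: "i \<ge> CARD('d) \<Longrightarrow> coord (a :: ('m::nontriv, 'd::{finite, linorder}) expo) i = 0"
  by (simp add: coord_def)

lemma coord_simps [simp]:
  "coord 0 i = 0" "coord (a + b) i = coord a i + coord b i"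
  "coord (- a) i = - coord a i" "coord (a - b) i = coord a i - coord b i"
  by (simp_all add: coord_def)

lemma coord_eqI:
  assumes "\<And>i. coord a i = coord b i"
  shows "a = b"
proof -
  have "a $ k = b $ k" for k
  proof -
    obtain i where "i < CARD('b)" "nth_gen i = k"
      by (rule nth_gen_surj)
    then show ?thesis
      using assms [of i] by (simp add: coord_def)
  qed
  then show ?thesis
    by (simp add: Finite_Cartesian_Product.vec_eq_iff)
qed

lemma expo_of_coord:
  fixes f :: "nat \<Rightarrow> 'm::nontriv mod_ring"
  obtains a :: "('m, 'd::{finite, linorder}) expo"
  where "\<And>i. coord a i = (if i < CARD('d) then f i else 0)"
proof -
  define a :: "('m, 'd) expo" where "a = (\<chi> k. f (the_inv_into {..<CARD('d)} nth_gen k))"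
  have "a $ nth_gen i = f i" if "i < CARD('d)" for i
    using that bij_nth_gen [where 'd = 'd] by (simp add: a_def bij_betw_def the_inv_into_f_f)
  then show thesis
    by (intro that [of a]) (simp add: coord_def)
qed

text \<open>The inner sum over smaller generators in \<open>twist\<close> is a partial sum of
  coordinates; the isotropic subgroup is chosen so that these partial sums nearly all
  cancel.\<close>

definition psum :: "('m::nontriv, 'd::{finite, linorder}) expo \<Rightarrow> nat \<Rightarrow> 'm mod_ring" where
  "psum a i = (\<Sum>j<i. coord a j)"

lemma psum_Suc: "psum a (Suc i) = psum a i + coord a i"
  by (simp add: psum_def)

definition tform :: "('m::nontriv, 'd::{finite, linorder}) expo \<Rightarrow> ('m, 'd) expo \<Rightarrow> 'm mod_ring" where
  "tform a b = (\<Sum>i<CARD('d). coord a i * psum b i)"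

lemma twist_tform: "twist a b = ring_char (- tform a b)"
  for a b :: "('m::nontriv, 'd::{finite, linorder}) expo"
proof -
  have "twist a b = ring_char (- (\<Sum>l\<in>UNIV. \<Sum>k\<in>{k. k < l}. a $ l * b $ k))"
    unfolding twist_def ring_char_of_int [symmetric]
    by (simp add: of_int_to_int_mod_ring)
  also have "(\<Sum>l\<in>UNIV. \<Sum>k\<in>{k. k < l}. a $ l * b $ k)
      = (\<Sum>i<CARD('d). \<Sum>k\<in>{k. k < nth_gen i}. a $ nth_gen i * b $ k)"
    by (rule sum.reindex_bij_betw [OF bij_nth_gen, symmetric])
  also have "\<dots> = (\<Sum>i<CARD('d). coord a i * psum b i)"
  proof (intro sum.cong refl)
    fix i assume "i \<in> {..<CARD('d)}"
    then have i: "i < CARD('d)" by simp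
    have "bij_betw nth_gen {..<i} {k :: 'd. k < nth_gen i}"
      unfolding bij_betw_def
    proof
      show "inj_on (nth_gen :: nat \<Rightarrow> 'd) {..<i}"
        using bij_nth_gen [where 'd = 'd] i unfolding bij_betw_def by (elim conjE inj_on_subset) auto
      show "nth_gen ` {..<i} = {k :: 'd. k < nth_gen i}"
      proof (intro equalityI subsetI)
        fix k :: 'd assume "k \<in> {k. k < nth_gen i}"
        moreover obtain j where "j < CARD('d)" "nth_gen j = k"
          by (rule nth_gen_surj)
        ultimately show "k \<in> nth_gen ` {..<i}"
          using i nth_gen_less_iff by auto
      qed (use i in \<open>auto simp: nth_gen_less_iff\<close>)
    qed
    from sum.reindex_bij_betw [OF this, of "\<lambda>k. a $ nth_gen i * b $ k"]
    show "(\<Sum>k\<in>{k. k < nth_gen i}. a $ nth_gen i * b $ k) = coord a i * psum b i"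
      using i by (simp add: coord_def psum_def sum_distrib_left)
  qed
  finally show ?thesis
    by (simp add: tform_def)
qed

text \<open>Generated by the exponents with -1 at position 2k and 1 at position 2k+1. For odd d the
  last coordinate is forced to be 0, because its partner is out of range and read as 0.\<close>

definition isotropic :: "('m::nontriv, 'd::{finite, linorder}) expo set" where
  "isotropic = {a. \<forall>k. coord a (2 * k) + coord a (2 * k + 1) = 0}"

text \<open>Exponents supported at even positions, including the unpaired last one when d is
  odd.\<close>

definition transversal :: "('m::nontriv, 'd::{finite, linorder}) expo set" where
  "transversal = {a. \<forall>k. coord a (2 * k + 1) = 0}"

lemma psum_isotropic:
  assumes "a \<in> isotropic"
  shows "psum a (2 * k) = 0" "psum a (2 * k + 1) = - coord a (2 * k + 1)"
proof -
  have eq: "coord a (2 * k) = - coord a (2 * k + 1)" for k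
    using assms by (simp add: isotropic_def eq_neg_iff_add_eq_0)
  show even: "psum a (2 * k) = 0"
  proof (induction k)
    case (Suc k)
    then show ?case
      using eq [of k] by (simp add: psum_Suc)
  qed (simp add: psum_def)
  show "psum a (2 * k + 1) = - coord a (2 * k + 1)"
    using even eq [of k] by (simp add: psum_Suc)
qed

lemma psum_isotropic_total: "psum a CARD('d) = 0"
  if "a \<in> isotropic" for a :: "('m::nontriv, 'd::{finite, linorder}) expo"
proof (cases "even CARD('d)")
  case True
  then show ?thesis
    using psum_isotropic(1) [OF that] by (metis evenE)
next
  case False
  then obtain k where "CARD('d) = 2 * k + 1" by (metis oddE)
  \<comment> \<open>Here \<open>2 * k + 1\<close> is d itself, out of range, so the default value 0
    of \<open>coord\<close> gives the claim.\<close>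
  then show ?thesis
    using psum_isotropic(2) [OF that, of k] coord_ge [of "2 * k + 1" a] by simp
qed

text \<open>The partial sum of \<open>b\<close> is 0 before an even position and minus the
  coordinate at an odd one. The form is thus symmetric on the subgroup, so its monomials commute,
  and diagonal, so a character can be built one pair at a time.\<close>

lemma tform_isotropic:
  fixes a b :: "('m::nontriv, 'd::{finite, linorder}) expo"
  assumes "b \<in> isotropic"
  shows "tform a b = (\<Sum>i | i < CARD('d) \<and> odd i. - (coord a i * coord b i))"
proof -
  have "tform a b = (\<Sum>i<CARD('d). if odd i then - (coord a i * coord b i) else 0)"
    unfolding tform_def
  proof (intro sum.cong refl)
    fix i
    show "coord a i * psum b i = (if odd i then - (coord a i * coord b i) else 0)"
      using psum_isotropic [OF assms] by (cases "even i") (auto elim!: evenE oddE)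
  qed
  also have "\<dots> = (\<Sum>i | i < CARD('d) \<and> odd i. - (coord a i * coord b i))"
    by (simp add: sum.If_cases Int_def)
  finally show ?thesis .
qed

text \<open>
  For even $m$ the character of the isotropic subgroup is not a character of the residues: it
  involves a square root $\zeta$ of $\omega$, through $n \mapsto \zeta^{-n(n+m)}$, where the summand $m$
  makes this quadratic function well defined modulo $m$ for either parity of $m$.
\<close>

definition root_omega :: "'m::nontriv itself \<Rightarrow> complex" where
  "root_omega _ = exp (of_real pi * \<i> / of_nat CARD('m))"

lemma root_omega_nonzero [simp]: "root_omega T \<noteq> 0"
  by (simp add: root_omega_def)

lemma root_omega_square: "root_omega TYPE('m::nontriv) powi (2 * n) = omega TYPE('m) powi n"
proof -
  have "root_omega TYPE('m) powi 2 = omega TYPE('m)"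
    by (simp add: root_omega_def omega_def mult.assoc flip: exp_of_nat_mult)
  then show ?thesis
    by (simp add: power_int_mult)
qed

definition quad_char :: "'m::nontriv mod_ring \<Rightarrow> complex" where
  "quad_char x = root_omega TYPE('m) powi (- (to_int_mod_ring x * (to_int_mod_ring x + int CARD('m))))"

lemma quad_char_of_int:
  "quad_char (of_int n :: 'm::nontriv mod_ring) = root_omega TYPE('m) powi (- (n * (n + int CARD('m))))"
proof -
  let ?m = "int CARD('m)" and ?n = "to_int_mod_ring (of_int n :: 'm mod_ring)"
  have "[?n = n] (mod ?m)"
    by (simp add: cong_def of_int_of_int_mod_ring of_int_mod_ring.rep_eq to_int_mod_ring.rep_eq)
  then obtain k where k: "n = ?n + ?m * k"
    by (auto simp: cong_iff_lin)
  \<comment> \<open>Changing the representative by \<open>?m * k\<close> changes the exponent by an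
    even number plus the square of m times \<open>k * (k + 1)\<close>. As this last factor is even,
    the change is a power of \<open>omega\<close> with exponent divisible by m.\<close>
  obtain j where j: "k * (k + 1) = 2 * j"
    by (metis evenE even_mult_iff odd_add odd_one)
  have "n * (n + ?m) = ?n * (?n + ?m) + ?m * (2 * ?n * k + ?m * (k * (k + 1)))"
    by (subst k, subst (2) k) (simp add: algebra_simps)
  then have "- (n * (n + ?m)) = - (?n * (?n + ?m)) + 2 * (?m * (- (?n * k + ?m * j)))"
    unfolding j by (simp add: algebra_simps)
  then have "root_omega TYPE('m) powi (- (n * (n + ?m)))
      = quad_char (of_int n :: 'm mod_ring) * omega TYPE('m) powi (?m * (- (?n * k + ?m * j)))"
    unfolding quad_char_def by (simp only: power_int_add root_omega_nonzero simp_thms root_omega_square)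
  also have "omega TYPE('m) powi (?m * (- (?n * k + ?m * j))) = 1"
    using omega_powi_cong [of "?m * (- (?n * k + ?m * j))" 0, where 'm = 'm] by (simp add: cong_def)
  finally show ?thesis by simp
qed

text \<open>Polarization: the quadratic function n(n+m) has mixed term 2xy, and the square of
  \<open>root_omega\<close> is \<open>omega\<close>.\<close>

lemma quad_char_mult: "quad_char x * quad_char y = ring_char (x * y) * quad_char (x + y)"
  for x y :: "'m::nontriv mod_ring"
proof -
  let ?m = "int CARD('m)" and ?x = "to_int_mod_ring x" and ?y = "to_int_mod_ring y"
  have "ring_char (x * y) = root_omega TYPE('m) powi (2 * (?x * ?y))"
    using ring_char_of_int [of "?x * ?y", where 'm = 'm]
    by (simp add: of_int_to_int_mod_ring root_omega_square)
  moreover have "quad_char (x + y) = root_omega TYPE('m) powi (- ((?x + ?y) * (?x + ?y + ?m)))"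
    using quad_char_of_int [of "?x + ?y", where 'm = 'm] by (simp add: of_int_to_int_mod_ring)
  ultimately show ?thesis
    by (simp add: quad_char_def algebra_simps flip: power_int_add)
qed

lemma norm_quad_char: "cmod (quad_char x) = 1"
  by (simp add: quad_char_def norm_power_int root_omega_def)

lemma card_transversal:
  "card (transversal :: ('m::nontriv, 'd::{finite, linorder}) expo set) = CARD('m) ^ ((CARD('d) + 1) div 2)"
proof -
  let ?K = "{..<(CARD('d) + 1) div 2}"
  let ?f = "\<lambda>a :: ('m, 'd) expo. restrict (\<lambda>k. coord a (2 * k)) ?K"
  have "bij_betw ?f transversal (?K \<rightarrow>\<^sub>E UNIV)"
    unfolding bij_betw_def
  proof
    show "inj_on ?f transversal"
    proof (rule inj_onI, rule coord_eqI)
      fix a b :: "('m, 'd) expo" and i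
      assume ab: "a \<in> transversal" "b \<in> transversal" and eq: "?f a = ?f b"
      show "coord a i = coord b i"
      proof (cases "even i")
        case True
        then obtain k where k: "i = 2 * k" by (elim evenE)
        show ?thesis
        proof (cases "i < CARD('d)")
          case True
          then have "k \<in> ?K" using k by auto
          then show ?thesis
            using fun_cong [OF eq, of k] k by simp
        qed (simp add: coord_ge)
      next
        case False
        then show ?thesis
          using ab by (auto simp: transversal_def elim!: oddE)
      qed
    qed
    show "?f ` transversal = (?K \<rightarrow>\<^sub>E UNIV)"
    proof (intro equalityI subsetI)
      fix g assume "g \<in> ?f ` transversal"
      then obtain a where "g = ?f a" by blast
      then show "g \<in> ?K \<rightarrow>\<^sub>E UNIV"
        by (simp only: restrict_PiE_iff) simp
    next
      fix g :: "nat \<Rightarrow> 'm mod_ring" assume g: "g \<in> ?K \<rightarrow>\<^sub>E UNIV"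
      obtain a :: "('m, 'd) expo" where
        a: "\<And>i. coord a i = (if i < CARD('d) then (if even i then g (i div 2) else 0) else 0)"
        using expo_of_coord [where 'd = 'd and f = "\<lambda>i. if even i then g (i div 2) else 0"] by blast
      have "a \<in> transversal"
        by (simp add: transversal_def a)
      moreover have "?f a = g"
        using g by (auto simp: a restrict_def PiE_def extensional_def fun_eq_iff)
      ultimately show "g \<in> ?f ` transversal"
        by blast
    qed
  qed
  then have "card (transversal :: ('m, 'd) expo set) = card (?K \<rightarrow>\<^sub>E (UNIV :: 'm mod_ring set))"
    by (rule bij_betw_same_card)
  then show ?thesis
    by (simp add: card_PiE)
qed

text \<open>By \<open>tform_isotropic\<close> only odd positions matter, where \<open>b\<close> is
  zero. Nondegeneracy thus only requires the other order of the arguments to give a value different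
  from 1.\<close>

lemma twist_isotropic_transversal:
  fixes a b :: "('m::nontriv, 'd::{finite, linorder}) expo"
  assumes "a \<in> isotropic" "b \<in> transversal"
  shows "twist b a = 1"
proof -
  have "coord b i = 0" if "odd i" for i
    using assms(2) that by (auto simp: transversal_def elim!: oddE)
  then have "tform b a = 0"
    unfolding tform_isotropic [OF assms(1)] by (intro sum.neutral) simp
  then show ?thesis
    by (simp add: twist_tform)
qed

lemma isotropic_nondegenerate:
  fixes a :: "('m::nontriv, 'd::{finite, linorder}) expo"
  assumes a: "a \<in> isotropic" "a \<noteq> 0"
  shows "\<exists>r\<in>transversal. twist a r \<noteq> twist r a"
proof -
  have "\<exists>k. coord a (2 * k + 1) \<noteq> 0"
  proof (rule ccontr)
    assume "\<not> ?thesis"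
    then have odd0: "coord a (2 * k + 1) = 0" for k by blast
    then have even0: "coord a (2 * k) = 0" for k
      using a by (simp add: isotropic_def)
    have "coord a i = 0" for i
      using odd0 even0 by (cases "even i") (auto elim!: evenE oddE)
    then have "a = 0"
      by (intro coord_eqI) simp
    with a show False by simp
  qed
  then obtain k where k: "coord a (2 * k + 1) \<noteq> 0" by blast
  then have kd: "2 * k + 1 < CARD('d)"
    by (rule contrapos_np) (simp add: coord_ge)
  \<comment> \<open>The witness is the generator at the even position of a pair on which
    \<open>a\<close> is nonzero; it fails to commute with the product attached to that pair.\<close>
  obtain r :: "('m, 'd) expo" where r: "\<And>i. coord r i = (if i = 2 * k then 1 else 0)"
  proof -
    obtain r :: "('m, 'd) expo" where "\<And>i. coord r i = (if i < CARD('d) then (if i = 2 * k then 1 else 0) else 0)"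
      using expo_of_coord [where 'd = 'd and f = "\<lambda>i. if i = 2 * k then 1 else 0"] by blast
    then show thesis
      using kd by (intro that [of r]) auto
  qed
  have rR: "r \<in> transversal"
    by (simp add: transversal_def r) presburger
  have "psum r i = (if 2 * k < i then 1 else 0)" for i
    by (simp add: psum_def r)
  then have "tform a r = (\<Sum>i<CARD('d). if 2 * k < i then coord a i else 0)"
    unfolding tform_def by (intro sum.cong refl) simp
  also have "\<dots> = (\<Sum>i<CARD('d). coord a i) - (\<Sum>i<CARD('d). if i < 2 * k + 1 then coord a i else 0)"
    unfolding sum_subtractf [symmetric] by (intro sum.cong refl) auto
  also have "(\<Sum>i<CARD('d). if i < 2 * k + 1 then coord a i else 0) = (\<Sum>i<2 * k + 1. coord a i)"
    using kd by (intro sum.mono_neutral_cong_right) auto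
  \<comment> \<open>All coordinates of \<open>a\<close> sum to 0, and those up to position
    \<open>2 * k\<close> sum to minus the coordinate at \<open>2 * k + 1\<close>.\<close>
  also have "(\<Sum>i<CARD('d). coord a i) - (\<Sum>i<2 * k + 1. coord a i) = coord a (2 * k + 1)"
    using psum_isotropic_total [OF a(1)] psum_isotropic(2) [OF a(1), of k] by (simp add: psum_def)
  finally have "twist a r \<noteq> 1"
    using k by (simp add: twist_tform ring_char_eq_1_iff)
  then show ?thesis
    using rR twist_isotropic_transversal [OF a(1) rR] by (intro bexI [of _ r]) simp_all
qed

lemma transversal_nondegenerate:
  fixes r :: "('m::nontriv, 'd::{finite, linorder}) expo"
  assumes d: "even CARD('d)" and r: "r \<in> transversal" "r \<noteq> 0"
  shows "\<exists>l\<in>isotropic. twist l r \<noteq> twist r l"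
proof -
  have "\<exists>k. coord r (2 * k) \<noteq> 0"
  proof (rule ccontr)
    assume "\<not> ?thesis"
    then have "coord r i = 0" for i
      using r by (cases "even i") (auto simp: transversal_def elim!: evenE oddE)
    then have "r = 0"
      by (intro coord_eqI) simp
    with r show False by simp
  qed
  then obtain k where k: "coord r (2 * k) \<noteq> 0" by blast
  then have "2 * k < CARD('d)"
    by (rule contrapos_np) (simp add: coord_ge)
  \<comment> \<open>Even d guarantees that position \<open>2 * k\<close> has a partner.\<close>
  with d have kd: "2 * k + 1 < CARD('d)"
    by presburger
  \<comment> \<open>The generator of the isotropic subgroup for the pair of \<open>k\<close>;
    pairing it with \<open>r\<close> takes the difference of two consecutive partial sums of
    \<open>r\<close>.\<close>
  obtain l :: "('m, 'd) expo" where l: "\<And>i. coord l i = (if i = 2 * k then - 1 else if i = 2 * k + 1 then 1 else 0)"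
  proof -
    obtain l :: "('m, 'd) expo" where
      "\<And>i. coord l i = (if i < CARD('d) then (if i = 2 * k then - 1 else if i = 2 * k + 1 then 1 else 0) else 0)"
      using expo_of_coord [where 'd = 'd and f = "\<lambda>i. if i = 2 * k then - 1 else if i = 2 * k + 1 then 1 else 0"] by blast
    then show thesis
      using kd by (intro that [of l]) auto
  qed
  have lL: "l \<in> isotropic"
    by (simp add: isotropic_def l)
  have "tform l r = (\<Sum>i<CARD('d). (if i = 2 * k then - psum r i else 0) + (if i = 2 * k + 1 then psum r i else 0))"
    unfolding tform_def by (intro sum.cong refl) (auto simp: l)
  also have "\<dots> = coord r (2 * k)"
    using kd by (simp add: sum.distrib psum_Suc)
  finally have "twist l r \<noteq> 1"
    using k by (simp add: twist_tform ring_char_eq_1_iff)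
  then show ?thesis
    using lL twist_isotropic_transversal [OF lL r(1)] by (intro bexI [of _ l]) simp_all
qed

definition isotropic_char :: "('m::nontriv, 'd::{finite, linorder}) expo \<Rightarrow> complex" where
  "isotropic_char a = (\<Prod>i | i < CARD('d) \<and> odd i. quad_char (coord a i))"

text \<open>The signs in \<open>twist_tform\<close> and \<open>tform_isotropic\<close> cancel, so
  \<open>quad_char_mult\<close> applies at each odd position.\<close>

lemma isotropic_char_mult:
  fixes a b :: "('m::nontriv, 'd::{finite, linorder}) expo"
  assumes "b \<in> isotropic"
  shows "isotropic_char a * isotropic_char b = twist a b * isotropic_char (a + b)"
proof -
  have "twist a b = (\<Prod>i | i < CARD('d) \<and> odd i. ring_char (coord a i * coord b i))"
    by (simp add: twist_tform tform_isotropic [OF assms] sum_negf ring_char_sum)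
  then show ?thesis
    unfolding isotropic_char_def prod.distrib [symmetric] quad_char_mult coord_simps by simp
qed

lemma splitting_decomp:
  fixes a :: "('m::nontriv, 'd::{finite, linorder}) expo"
  shows "\<exists>r\<in>transversal. \<exists>l\<in>isotropic. a = r + l"
proof -
  \<comment> \<open>\<open>l\<close> must agree with \<open>a\<close> at odd positions, and isotropy
    then dictates the even ones. At an unpaired last position \<open>coord a (i + 1)\<close> is the
    default 0.\<close>
  obtain l :: "('m, 'd) expo" where l: "\<And>i. coord l i
      = (if i < CARD('d) then (if odd i then coord a i else - coord a (i + 1)) else 0)"
    using expo_of_coord [where 'd = 'd and f = "\<lambda>i. if odd i then coord a i else - coord a (i + 1)"] by blast
  have "l \<in> isotropic"
    using coord_ge [where a = a] by (auto simp: isotropic_def l)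
  moreover have "a - l \<in> transversal"
    using coord_ge [where a = a] by (auto simp: transversal_def l)
  ultimately show ?thesis
    by (metis diff_add_cancel)
qed

section \<open>Eigenvalues and Newton's identities\<close>

definition mat_trace :: "'a::comm_ring_1 mat \<Rightarrow> 'a" where
  "mat_trace A = (\<Sum>i<dim_row A. A $$ (i, i))"

lemma mat_trace_mult_commute:
  assumes A: "A \<in> carrier_mat n m" and B: "B \<in> carrier_mat m n"
  shows "mat_trace (A * B) = mat_trace (B * A)"
proof -
  have "mat_trace (A * B) = (\<Sum>i<n. \<Sum>j<m. A $$ (i, j) * B $$ (j, i))"
    using A B by (simp add: mat_trace_def scalar_prod_def atLeast0LessThan)
  also have "\<dots> = (\<Sum>j<m. \<Sum>i<n. B $$ (j, i) * A $$ (i, j))"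
    by (subst sum.swap) (simp add: mult.commute)
  also have "\<dots> = mat_trace (B * A)"
    using A B by (simp add: mat_trace_def scalar_prod_def atLeast0LessThan)
  finally show ?thesis .
qed

lemma mat_trace_similar:
  assumes "similar_mat A B" "A \<in> carrier_mat n n"
  shows "mat_trace A = mat_trace B"
proof -
  obtain P Q where "similar_mat_wit A B P Q"
    using assms(1) by (auto simp: similar_mat_def)
  note wit = similar_mat_witD2 [OF assms(2) this]
  have "mat_trace A = mat_trace (P * (B * Q))"
    using wit by simp
  also have "\<dots> = mat_trace ((B * Q) * P)"
    using wit by (intro mat_trace_mult_commute) auto
  also have "(B * Q) * P = B"
    using wit by (simp add: assoc_mult_mat [of B n n Q n P n])
  finally show ?thesis .
qed

lemma upper_triangular_mult:
  assumes A: "A \<in> carrier_mat n n" "upper_triangular A" and B: "B \<in> carrier_mat n n" "upper_triangular B"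
  shows "upper_triangular (A * B)" and "i < n \<Longrightarrow> (A * B) $$ (i, i) = A $$ (i, i) * B $$ (i, i)"
proof -
  have entry: "(A * B) $$ (i, j) = (\<Sum>k<n. A $$ (i, k) * B $$ (k, j))" if "i < n" "j < n" for i j
    using that A B by (simp add: scalar_prod_def atLeast0LessThan)
  have z: "A $$ (i, k) * B $$ (k, j) = 0" if "i < n" "k < n" "k < i \<or> j < k" for i j k
    using that A B unfolding upper_triangular_def by auto
  show "upper_triangular (A * B)"
  proof (rule upper_triangularI)
    fix i j assume "j < i" "i < dim_row (A * B)"
    then have ij: "j < i" "i < n" "j < n" using A by auto
    show "(A * B) $$ (i, j) = 0"
      unfolding entry [OF ij(2,3)] by (intro sum.neutral ballI z) (use ij in auto)
  qed
  show "(A * B) $$ (i, i) = A $$ (i, i) * B $$ (i, i)" if "i < n"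
  proof -
    have "(A * B) $$ (i, i) = (\<Sum>k<n. if k = i then A $$ (i, i) * B $$ (i, i) else 0)"
      unfolding entry [OF that that]
    proof (intro sum.cong refl)
      fix k assume "k \<in> {..<n}"
      then show "A $$ (i, k) * B $$ (k, i) = (if k = i then A $$ (i, i) * B $$ (i, i) else 0)"
        using that z [of i k i] by (cases k i rule: linorder_cases) auto
    qed
    then show ?thesis using that by simp
  qed
qed

lemma upper_triangular_pow:
  assumes "A \<in> carrier_mat n n" "upper_triangular A"
  shows "upper_triangular (A ^\<^sub>m k) \<and> (\<forall>i<n. (A ^\<^sub>m k) $$ (i, i) = A $$ (i, i) ^ k)"
proof (induction k)
  case (Suc k)
  then show ?case
    using upper_triangular_mult [of "A ^\<^sub>m k" n A] assms by (simp add: pow_carrier_mat power_commutes)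
qed (use assms in auto)

text \<open>One Schur triangularization yields a single list serving both uses: power sums for
  Newton's identities, and the product for the derivative of the determinant at 1.\<close>

lemma complex_mat_eigenvalues:
  fixes A :: "complex mat"
  assumes A: "A \<in> carrier_mat n n"
  obtains es where "length es = n" "det A = prod_list es"
    "\<And>k. mat_trace (A ^\<^sub>m k) = (\<Sum>e\<leftarrow>es. e ^ k)"
    "\<And>t. det (1\<^sub>m n + t \<cdot>\<^sub>m A) = (\<Prod>e\<leftarrow>es. 1 + t * e)"
proof -
  obtain as where "char_poly A = (\<Prod>a\<leftarrow>as. [:- a, 1:])"
    using char_poly_factorized [OF A] by blast
  then obtain B where B: "B \<in> carrier_mat n n" "upper_triangular B" and sim: "similar_mat A B"
    using schur_decomposition_exists [OF A] by blast
  obtain P Q where wit: "similar_mat_wit A B P Q"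
    using sim by (auto simp: similar_mat_def)
  note PQ = similar_mat_witD2 [OF A wit]
  show thesis
  proof (rule that [of "diag_mat B"])
    show "length (diag_mat B) = n"
      using B by (simp add: diag_mat_def)
    show "det A = prod_list (diag_mat B)"
      using det_similar [OF sim] det_upper_triangular [OF B(2,1)] by simp
    show "mat_trace (A ^\<^sub>m k) = (\<Sum>e\<leftarrow>diag_mat B. e ^ k)" for k
    proof -
      have "similar_mat (A ^\<^sub>m k) (B ^\<^sub>m k)"
        using similar_mat_wit_pow [OF wit, of k] by (auto simp: similar_mat_def)
      then have "mat_trace (A ^\<^sub>m k) = mat_trace (B ^\<^sub>m k)"
        using A by (intro mat_trace_similar) auto
      also have "\<dots> = (\<Sum>i<n. B $$ (i, i) ^ k)"
        using upper_triangular_pow [OF B, of k] B(1) by (simp add: mat_trace_def)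
      also have "\<dots> = (\<Sum>e\<leftarrow>diag_mat B. e ^ k)"
        using B(1) by (simp add: diag_mat_def sum_list_sum_nth atLeast0LessThan o_def)
      finally show ?thesis .
    qed
    show "det (1\<^sub>m n + t \<cdot>\<^sub>m A) = (\<Prod>e\<leftarrow>diag_mat B. 1 + t * e)" for t
    proof -
      let ?B = "1\<^sub>m n + t \<cdot>\<^sub>m B"
      have "P * ?B * Q = P * 1\<^sub>m n * Q + t \<cdot>\<^sub>m (P * B * Q)"
      proof -
        have "P * ?B = P * 1\<^sub>m n + t \<cdot>\<^sub>m (P * B)"
          using PQ B by (simp add: mult_add_distrib_mat [of P n n _ n] mult_smult_distrib [of P n n B n])
        moreover have "(P * 1\<^sub>m n + t \<cdot>\<^sub>m (P * B)) * Q = P * 1\<^sub>m n * Q + t \<cdot>\<^sub>m (P * B) * Q"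
          using PQ B by (intro add_mult_distrib_mat [of _ n n]) auto
        moreover have "t \<cdot>\<^sub>m (P * B) * Q = t \<cdot>\<^sub>m (P * B * Q)"
          using PQ B by (intro mult_smult_assoc_mat [of _ n n _ n]) auto
        ultimately show ?thesis by simp
      qed
      then have eq: "1\<^sub>m n + t \<cdot>\<^sub>m A = P * ?B * Q"
        using PQ by simp
      have "similar_mat (1\<^sub>m n + t \<cdot>\<^sub>m A) ?B"
        unfolding similar_mat_def
        by (intro exI, rule similar_mat_witI [OF _ _ eq]) (use PQ B A in auto)
      then have "det (1\<^sub>m n + t \<cdot>\<^sub>m A) = det ?B"
        by (rule det_similar)
      also have "\<dots> = prod_list (diag_mat ?B)"
        using B by (intro det_upper_triangular [of _ n] upper_triangularI) (auto dest: upper_triangularD)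
      also have "diag_mat ?B = map (\<lambda>e. 1 + t * e) (diag_mat B)"
        using B by (simp add: diag_mat_def)
      finally show ?thesis .
    qed
  qed
qed

text \<open>Newton's identities, as the logarithmic derivative of $\prod_e (1 - e X)$.\<close>

definition reverse_char :: "complex list \<Rightarrow> complex fps" where
  "reverse_char es = (\<Prod>e\<leftarrow>es. 1 - fps_const e * fps_X)"

text \<open>Each factor contributes the geometric series of \<open>-e / (1 - e X)\<close> to the
  logarithmic derivative; multiplying through by the product avoids division.\<close>

lemma reverse_char_deriv:
  "fps_deriv (reverse_char es) = - (reverse_char es * Abs_fps (\<lambda>k. \<Sum>e\<leftarrow>es. e ^ Suc k))"
proof (induction es)
  case Nil
  have "Abs_fps (\<lambda>k. 0 :: complex) = 0"
    by (simp add: fps_eq_iff)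
  then show ?case by (simp add: reverse_char_def)
next
  case (Cons e es)
  let ?S = "Abs_fps (\<lambda>k. \<Sum>e\<leftarrow>es. e ^ Suc k)" and ?G = "Abs_fps (\<lambda>k. e ^ Suc k)"
  have geom: "(1 - fps_const e * fps_X) * ?G = fps_const e"
  proof (rule fps_ext)
    fix k
    have "(1 - fps_const e * fps_X) * ?G = ?G - fps_const e * (fps_X * ?G)"
      by (simp add: algebra_simps)
    then show "fps_nth ((1 - fps_const e * fps_X) * ?G) k = fps_nth (fps_const e) k"
      by (cases k) simp_all
  qed
  have S: "Abs_fps (\<lambda>k. \<Sum>e\<leftarrow>e # es. e ^ Suc k) = ?G + ?S"
    by (simp add: fps_eq_iff)
  have "fps_deriv (reverse_char (e # es))
      = - (fps_const e * reverse_char es) - (1 - fps_const e * fps_X) * (reverse_char es * ?S)"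
    using Cons.IH by (simp add: reverse_char_def algebra_simps)
  also have "\<dots> = - ((1 - fps_const e * fps_X) * reverse_char es * (?G + ?S))"
  proof -
    have "(1 - fps_const e * fps_X) * reverse_char es * (?G + ?S)
        = (1 - fps_const e * fps_X) * ?G * reverse_char es + (1 - fps_const e * fps_X) * (reverse_char es * ?S)"
      by (simp only: distrib_left mult_ac)
    then show ?thesis
      unfolding geom by simp
  qed
  finally show ?case
    unfolding S by (simp add: reverse_char_def)
qed

lemma reverse_char_nth_Suc:
  "of_nat (Suc k) * fps_nth (reverse_char es) (Suc k)
    = - (\<Sum>i\<le>k. fps_nth (reverse_char es) i * (\<Sum>e\<leftarrow>es. e ^ Suc (k - i)))"
  using arg_cong [OF reverse_char_deriv [of es], of "\<lambda>f. fps_nth f k"]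
  by (simp add: fps_mult_nth atLeast0AtMost)

lemma reverse_char_nth_0: "fps_nth (reverse_char es) 0 = 1"
  by (induction es) (simp_all add: reverse_char_def)

lemma reverse_char_nth_length:
  "fps_nth (reverse_char es) (length es) = (- 1) ^ length es * prod_list es"
proof -
  \<comment> \<open>Vanishing above the degree is carried along: the top coefficient of a product
    with one more factor also involves the coefficient of the shorter product just beyond its
    length.\<close>
  have "(\<forall>k>length es. fps_nth (reverse_char es) k = 0) \<and>
    fps_nth (reverse_char es) (length es) = (- 1) ^ length es * prod_list es"
  proof (induction es)
    case (Cons e es)
    have rec: "fps_nth (reverse_char (e # es)) (Suc k)
        = fps_nth (reverse_char es) (Suc k) - e * fps_nth (reverse_char es) k" for k
    proof -
      have "reverse_char (e # es) = reverse_char es - fps_const e * (fps_X * reverse_char es)"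
        by (simp add: reverse_char_def algebra_simps)
      then show ?thesis by simp
    qed
    have "fps_nth (reverse_char (e # es)) k = 0" if "k > length (e # es)" for k
      using Cons.IH that by (cases k) (simp_all add: rec)
    moreover have "fps_nth (reverse_char (e # es)) (length (e # es)) = (- 1) ^ length (e # es) * prod_list (e # es)"
      using Cons.IH by (simp add: rec)
    ultimately show ?case by blast
  qed (simp add: reverse_char_def)
  then show ?thesis by blast
qed

lemma mat_adjoint_index:
  "i < dim_col A \<Longrightarrow> j < dim_row A \<Longrightarrow> mat_adjoint A $$ (i, j) = conjugate (A $$ (j, i))"
  by (simp add: mat_adjoint_def mat_of_rows_index)

lemma det_mat_adjoint:
  fixes A :: "complex mat"
  assumes A: "A \<in> carrier_mat n n"
  shows "det (mat_adjoint A) = cnj (det A)"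
proof -
  interpret cnj: comm_ring_hom cnj
    by unfold_locales simp_all
  have "mat_adjoint A = map_mat cnj (transpose_mat A)"
    using A by (intro eq_matI) (auto simp: mat_adjoint_index, auto simp: mat_adjoint_def)
  then show ?thesis
    using A det_transpose [OF A] by simp
qed

section \<open>The determinant\<close>

lemma ex_gca_splitting:
  obtains chi :: "('m::nontriv, 'd::{finite, linorder}) expo \<Rightarrow> complex" and idx
  where "gca_splitting isotropic transversal chi (det_size TYPE(('m, 'd) gca)) idx"
proof -
  have "\<exists>idx. bij_betw idx {..<det_size TYPE(('m, 'd) gca)} (transversal :: ('m, 'd) expo set)"
    using ex_bij_betw_nat_finite [of "transversal :: ('m, 'd) expo set"]
    by (simp add: card_transversal det_size_def atLeast0LessThan)
  then obtain idx where idx: "bij_betw idx {..<det_size TYPE(('m, 'd) gca)} (transversal :: ('m, 'd) expo set)" ..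
  have "gca_splitting isotropic transversal
      (isotropic_char :: ('m, 'd) expo \<Rightarrow> complex) (det_size TYPE(('m, 'd) gca)) idx"
  proof
    fix a b :: "('m, 'd) expo"
    show "0 \<in> (isotropic :: ('m, 'd) expo set)" "0 \<in> (transversal :: ('m, 'd) expo set)"
      by (simp_all add: isotropic_def transversal_def)
    show "a \<in> isotropic \<Longrightarrow> b \<in> isotropic \<Longrightarrow> a + b \<in> isotropic"
      by (auto simp: isotropic_def add_eq_0_iff)
    show "a \<in> isotropic \<Longrightarrow> - a \<in> isotropic"
      by (auto simp: isotropic_def add_eq_0_iff)
    show "a \<in> transversal \<Longrightarrow> b \<in> transversal \<Longrightarrow> a + b \<in> transversal"
      "a \<in> transversal \<Longrightarrow> - a \<in> transversal"
      by (simp_all add: transversal_def)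
    show "\<exists>r\<in>transversal. \<exists>l\<in>isotropic. a = r + l"
      by (rule splitting_decomp)
    show "cmod (isotropic_char a) = 1"
      by (simp add: isotropic_char_def norm_quad_char flip: prod_norm)
    show "a = 0" if "a \<in> isotropic" "a \<in> transversal"
    proof (rule coord_eqI)
      fix i
      show "coord a i = coord 0 i"
        using that by (cases "even i") (auto simp: isotropic_def transversal_def elim!: evenE oddE)
    qed
  qed (simp_all add: isotropic_char_mult isotropic_nondegenerate idx)
  then show thesis
    by (rule that)
qed

context gca_splitting
begin

lemma rep_power: "rep (U ^ k) = rep U ^\<^sub>m k"
  by (induction k) (simp_all add: rep_one rep_mult power_Suc2 del: power_Suc)

lemma mat_trace_rep: "mat_trace (rep U) = of_nat N * scalar_part U"
  by (simp add: mat_trace_def trace_rep)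

end

text \<open>Unrolled, the recursion is a polynomial in \<open>U\<close> with scalar coefficients, so
  its scalar part is expressed by traces of powers.\<close>

lemma det_iter_expand:
  "det_iter U (Suc k) = U ^ Suc k - (\<Sum>i<k. cscale (det_coeff U (Suc i)) (U ^ (k - i)))"
proof (induction k)
  case (Suc k)
  have "det_iter U (Suc (Suc k)) = U * det_iter U (Suc k) - cscale (det_coeff U (Suc k)) U"
    by (simp add: det_coeff_def right_diff_distrib cscale_one_mult)
  also have "U * det_iter U (Suc k) = U ^ Suc (Suc k) - (\<Sum>i<k. cscale (det_coeff U (Suc i)) (U ^ (Suc k - i)))"
  proof -
    have "(\<Sum>i<k. U * cscale (det_coeff U (Suc i)) (U ^ (k - i)))
        = (\<Sum>i<k. cscale (det_coeff U (Suc i)) (U ^ (Suc k - i)))"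
      by (intro sum.cong refl) (simp add: cscale_algebra(6) Suc_diff_le)
    then show ?thesis
      unfolding Suc.IH right_diff_distrib sum_distrib_left power_Suc by simp
  qed
  finally show ?case
    by (simp add: algebra_simps)
qed simp

lemma gdet_via_traces:
  fixes U :: "('m::nontriv, 'd::{finite, linorder}) gca"
  assumes tr: "\<And>k. of_nat (det_size TYPE(('m, 'd) gca)) * scalar_part (U ^ k) = (\<Sum>e\<leftarrow>es. e ^ k)"
    and len: "length es = det_size TYPE(('m, 'd) gca)"
  shows "gdet U = prod_list es"
proof -
  let ?N = "det_size TYPE(('m, 'd) gca)" and ?r = "fps_nth (reverse_char es)"
  let ?p = "\<lambda>k. \<Sum>e\<leftarrow>es. e ^ k"
  \<comment> \<open>Both sides satisfy the same recursion: the minus sign matches the subtracted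
    terms, and the isolated power sum is the term \<open>i = 0\<close> of Newton's identity, where
    the coefficient is 1.\<close>
  have coeff: "det_coeff U (Suc k) = - ?r (Suc k)" for k
  proof (induction k rule: less_induct)
    case (less k)
    have "of_nat (Suc k) * det_coeff U (Suc k) = of_nat ?N * scalar_part (det_iter U (Suc k))"
      by (simp add: det_coeff_def del: of_nat_Suc)
    also have "\<dots> = ?p (Suc k) - (\<Sum>i<k. det_coeff U (Suc i) * ?p (k - i))"
      unfolding det_iter_expand tr [symmetric]
      by (simp add: scalar_part_sum algebra_simps sum_distrib_left del: power_Suc)
    also have "\<dots> = ?p (Suc k) + (\<Sum>i<k. ?r (Suc i) * ?p (k - i))"
      using less by (simp add: sum_negf)
    also have "\<dots> = (\<Sum>i\<le>k. ?r i * ?p (Suc (k - i)))"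
    proof -
      have "(\<Sum>i\<le>k. ?r i * ?p (Suc (k - i))) = (\<Sum>i<Suc k. ?r i * ?p (Suc k - i))"
        by (rule sum.cong) (auto simp: Suc_diff_le)
      then show ?thesis
        by (simp add: sum.lessThan_Suc_shift reverse_char_nth_0 del: sum.lessThan_Suc)
    qed
    also have "\<dots> = of_nat (Suc k) * - ?r (Suc k)"
      using reverse_char_nth_Suc [of k es] by simp
    finally show ?case
      using of_nat_neq_0 [of k, where 'a = complex] by (metis mult_left_cancel)
  qed
  obtain k where k: "?N = Suc k"
    using gr0_implies_Suc [of ?N] by (auto simp: det_size_def)
  have "gdet U = - ((- 1) ^ (Suc k + 1) * ((- 1) ^ Suc k * prod_list es))"
    using coeff [of k] reverse_char_nth_length [of es] by (simp add: gdet_def k len)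
  also have "\<dots> = prod_list es"
    by (simp flip: power_add mult.assoc)
  finally show ?thesis .
qed

text \<open>Hides the choice of character and of the enumeration of the basis; what follows relies
  only on these properties.\<close>

lemma ex_gca_rep:
  defines "N \<equiv> det_size TYPE(('m::nontriv, 'd::{finite, linorder}) gca)"
  obtains rep :: "('m::nontriv, 'd::{finite, linorder}) gca \<Rightarrow> complex mat" where
    "\<And>U. rep U \<in> carrier_mat N N" "rep 1 = 1\<^sub>m N"
    "\<And>U V. rep (U + V) = rep U + rep V" "\<And>U V. rep (U - V) = rep U - rep V"
    "\<And>U. rep (- U) = - rep U"
    "\<And>c U. rep (cscale c U) = c \<cdot>\<^sub>m rep U"
    "\<And>U V. rep (U * V) = rep U * rep V" "\<And>U. rep (hconj U) = mat_adjoint (rep U)"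
    "\<And>U. mat_trace (rep U) = of_nat N * scalar_part U"
    "inj rep" "even CARD('d) \<Longrightarrow> range rep = carrier_mat N N"
    "\<And>U. gdet U = det (rep U)"
proof -
  obtain chi idx where sp: "gca_splitting isotropic transversal
      (chi :: ('m, 'd) expo \<Rightarrow> complex) (det_size TYPE(('m, 'd) gca)) idx"
    by (rule ex_gca_splitting)
  have N: "det_size TYPE(('m, 'd) gca) = N"
    by (simp add: N_def)
  interpret gca_splitting isotropic transversal chi N idx
    using sp unfolding N .
  show thesis
  proof (rule that [of rep])
    show "inj rep"
      by (simp add: inj_def rep_inject)
    show "range rep = carrier_mat N N" if "even CARD('d)"
      using rep_surj [OF transversal_nondegenerate [OF that]] by (auto simp: image_iff)
    show "gdet U = det (rep U)" for U
    proof -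
      obtain es where es: "length es = N" "det (rep U) = prod_list es"
        "\<And>k. mat_trace (rep U ^\<^sub>m k) = (\<Sum>e\<leftarrow>es. e ^ k)"
        by (rule complex_mat_eigenvalues [OF rep_carrier, of U]) blast
      then show ?thesis
        using gdet_via_traces [of U es] by (simp add: N rep_power [symmetric] mat_trace_rep)
    qed
  qed (simp_all add: rep_one rep_add rep_diff rep_uminus rep_cscale rep_mult rep_hconj mat_trace_rep)
qed

lemma gdet_mult: "gdet (U * V) = gdet U * gdet V"
  by (rule ex_gca_rep [where 'm = 'a and 'd = 'b]) (metis Determinant.det_mult)

lemma gdet_hconj: "gdet (hconj U) = cnj (gdet U)"
  by (rule ex_gca_rep [where 'm = 'a and 'd = 'b]) (metis det_mat_adjoint)

lemma gdet_one: "gdet 1 = 1"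
  by (rule ex_gca_rep [where 'm = 'a and 'd = 'b]) simp

text \<open>True for square matrices, and \<open>rep\<close> is injective.\<close>

lemma gca_left_inverse_imp_right_inverse:
  fixes U V :: "('m::nontriv, 'd::{finite, linorder}) gca"
  assumes "U * V = 1"
  shows "V * U = 1"
proof -
  obtain rep :: "('m, 'd) gca \<Rightarrow> complex mat" where
    rep: "\<And>U. rep U \<in> carrier_mat (det_size TYPE(('m, 'd) gca)) (det_size TYPE(('m, 'd) gca))"
      "rep 1 = 1\<^sub>m (det_size TYPE(('m, 'd) gca))" "\<And>U V. rep (U * V) = rep U * rep V" "inj rep"
    by (rule ex_gca_rep [where 'm = 'm and 'd = 'd]) blast
  have "rep U * rep V = 1\<^sub>m (det_size TYPE(('m, 'd) gca))"
    using assms by (simp flip: rep(2,3))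
  then have "rep V * rep U = 1\<^sub>m (det_size TYPE(('m, 'd) gca))"
    by (rule mat_mult_left_right_inverse [OF rep(1) rep(1)])
  then have "rep (V * U) = rep 1"
    by (simp add: rep)
  then show ?thesis
    using rep(4) by (simp add: inj_eq)
qed

lemma gdet_one_plus:
  fixes U :: "('m::nontriv, 'd::{finite, linorder}) gca"
  obtains es where "of_nat (det_size TYPE(('m, 'd) gca)) * scalar_part U = sum_list es"
    "\<And>t. gdet (1 + cscale t U) = (\<Prod>e\<leftarrow>es. 1 + t * e)"
proof -
  obtain rep :: "('m, 'd) gca \<Rightarrow> complex mat" where
    rep: "\<And>U. rep U \<in> carrier_mat (det_size TYPE(('m, 'd) gca)) (det_size TYPE(('m, 'd) gca))"
      "rep 1 = 1\<^sub>m (det_size TYPE(('m, 'd) gca))"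
      "\<And>U V. rep (U + V) = rep U + rep V" "\<And>c U. rep (cscale c U) = c \<cdot>\<^sub>m rep U"
      "\<And>U. mat_trace (rep U) = of_nat (det_size TYPE(('m, 'd) gca)) * scalar_part U"
      "\<And>U. gdet U = det (rep U)"
    by (rule ex_gca_rep [where 'm = 'm and 'd = 'd]) blast
  obtain es where es: "\<And>k. mat_trace (rep U ^\<^sub>m k) = (\<Sum>e\<leftarrow>es. e ^ k)"
    "\<And>t. det (1\<^sub>m (det_size TYPE(('m, 'd) gca)) + t \<cdot>\<^sub>m rep U) = (\<Prod>e\<leftarrow>es. 1 + t * e)"
    using complex_mat_eigenvalues [OF rep(1) [of U]] by metis
  show thesis
  proof (rule that [of es])
    have "rep U ^\<^sub>m 1 = rep U"
      using rep(1) [of U] by simp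
    then show "of_nat (det_size TYPE(('m, 'd) gca)) * scalar_part U = sum_list es"
      using es(1) [of 1] rep(5) [of U] by (simp del: pow_mat.simps)
    show "gdet (1 + cscale t U) = (\<Prod>e\<leftarrow>es. 1 + t * e)" for t
      by (simp add: rep es)
  qed
qed

section \<open>Smooth maps and the exponential curve\<close>

lemma Ck_on_SucI:
  "(\<And>x. x \<in> S \<Longrightarrow> (f has_derivative f' x) (at x)) \<Longrightarrow> (\<And>v. Ck_on k S (\<lambda>x. f' x v)) \<Longrightarrow> Ck_on (Suc k) S f"
  by auto

lemma Ck_on_SucE:
  assumes "Ck_on (Suc k) S f"
  obtains f' where "\<And>x. x \<in> S \<Longrightarrow> (f has_derivative f' x) (at x)" "\<And>v. Ck_on k S (\<lambda>x. f' x v)"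
  using assms by auto

text \<open>The product rule leaves one factor undifferentiated, so the induction for bilinear maps
  must lower the order of that factor.\<close>

lemma Ck_on_SucD: "Ck_on (Suc k) S f \<Longrightarrow> Ck_on k S f"
proof (induction k arbitrary: f)
  case 0
  then obtain f' where "\<And>x. x \<in> S \<Longrightarrow> (f has_derivative f' x) (at x)"
    by (rule Ck_on_SucE) blast
  then show ?case
    by (auto intro: continuous_at_imp_continuous_on has_derivative_continuous)
next
  case (Suc k)
  from Suc.prems obtain f' where
    f': "\<And>x. x \<in> S \<Longrightarrow> (f has_derivative f' x) (at x)" "\<And>v. Ck_on (Suc k) S (\<lambda>x. f' x v)"
    by (rule Ck_on_SucE) blast
  then show ?case
    by (intro Ck_on_SucI [of S f f'] Suc.IH)
qed

lemma Ck_on_const: "Ck_on k S (\<lambda>_. c)"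
proof (induction k arbitrary: c)
  case (Suc k)
  then show ?case
    by (intro Ck_on_SucI [of S _ "\<lambda>_ _. 0"] has_derivative_const)
qed simp

lemma Ck_on_id: "Ck_on k S (\<lambda>x. x)"
proof (cases k)
  case (Suc j)
  then show ?thesis
    using Ck_on_SucI [of S "\<lambda>x. x" "\<lambda>_ v. v" j] by (simp add: Ck_on_const)
qed simp

lemma Ck_on_compose_linear:
  assumes h: "bounded_linear h"
  shows "Ck_on k S f \<Longrightarrow> Ck_on k S (\<lambda>x. h (f x))"
proof (induction k arbitrary: f)
  case 0
  then show ?case
    using h by (auto intro: bounded_linear.continuous_on)
next
  case (Suc k)
  from Suc.prems obtain f' where "\<And>x. x \<in> S \<Longrightarrow> (f has_derivative f' x) (at x)" "\<And>v. Ck_on k S (\<lambda>x. f' x v)"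
    by (rule Ck_on_SucE) blast
  then show ?case
    by (intro Ck_on_SucI [of S _ "\<lambda>x v. h (f' x v)"] bounded_linear.has_derivative [OF h] Suc.IH)
qed

lemma Ck_on_add: "Ck_on k S f \<Longrightarrow> Ck_on k S g \<Longrightarrow> Ck_on k S (\<lambda>x. f x + g x)"
proof (induction k arbitrary: f g)
  case 0
  then show ?case
    by (auto intro: continuous_on_add)
next
  case (Suc k)
  from Suc.prems(1) obtain f' where f': "\<And>x. x \<in> S \<Longrightarrow> (f has_derivative f' x) (at x)" "\<And>v. Ck_on k S (\<lambda>x. f' x v)"
    by (rule Ck_on_SucE) blast
  from Suc.prems(2) obtain g' where g': "\<And>x. x \<in> S \<Longrightarrow> (g has_derivative g' x) (at x)" "\<And>v. Ck_on k S (\<lambda>x. g' x v)"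
    by (rule Ck_on_SucE) blast
  from f' g' show ?case
    by (intro Ck_on_SucI [of S _ "\<lambda>x v. f' x v + g' x v"] has_derivative_add Suc.IH)
qed

lemma Ck_on_bilinear:
  assumes h: "bounded_bilinear h"
  shows "Ck_on k S f \<Longrightarrow> Ck_on k S g \<Longrightarrow> Ck_on k S (\<lambda>x. h (f x) (g x))"
proof (induction k arbitrary: f g)
  case 0
  then show ?case
    using h by (auto intro: bounded_bilinear.continuous_on)
next
  case (Suc k)
  from Suc.prems(1) obtain f' where f': "\<And>x. x \<in> S \<Longrightarrow> (f has_derivative f' x) (at x)" "\<And>v. Ck_on k S (\<lambda>x. f' x v)"
    by (rule Ck_on_SucE) blast
  from Suc.prems(2) obtain g' where g': "\<And>x. x \<in> S \<Longrightarrow> (g has_derivative g' x) (at x)" "\<And>v. Ck_on k S (\<lambda>x. g' x v)"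
    by (rule Ck_on_SucE) blast
  from f' g' show ?case
    by (intro Ck_on_SucI [of S _ "\<lambda>x v. h (f x) (g' x v) + h (f' x v) (g x)"]
        bounded_bilinear.FDERIV [OF h] Ck_on_add Suc.IH Ck_on_SucD [OF Suc.prems(1)] Ck_on_SucD [OF Suc.prems(2)])
qed

lemma smooth_on_const: "smooth_on S (\<lambda>_. c)"
  and smooth_on_id: "smooth_on S (\<lambda>x. x)"
  and smooth_on_add: "smooth_on S f \<Longrightarrow> smooth_on S g \<Longrightarrow> smooth_on S (\<lambda>x. f x + g x)"
  by (auto simp: smooth_on_def intro: Ck_on_const Ck_on_id Ck_on_add)

lemma smooth_on_compose_linear: "bounded_linear h \<Longrightarrow> smooth_on S f \<Longrightarrow> smooth_on S (\<lambda>x. h (f x))"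
  by (auto simp: smooth_on_def intro: Ck_on_compose_linear)

lemma smooth_on_bilinear:
  "bounded_bilinear h \<Longrightarrow> smooth_on S f \<Longrightarrow> smooth_on S g \<Longrightarrow> smooth_on S (\<lambda>x. h (f x) (g x))"
  by (auto simp: smooth_on_def intro: Ck_on_bilinear)

lemma smooth_on_diff: "smooth_on S f \<Longrightarrow> smooth_on S g \<Longrightarrow> smooth_on S (\<lambda>x. f x - g x)"
  using smooth_on_add [of S f "\<lambda>x. - g x"]
    smooth_on_compose_linear [OF bounded_linear_minus [OF bounded_linear_ident], of S g] by simp

lemma smooth_on_has_derivative:
  assumes "smooth_on S f"
  obtains f' where "\<And>x. x \<in> S \<Longrightarrow> (f has_derivative f' x) (at x)"
  using assms [unfolded smooth_on_def, rule_format, of "Suc 0"] by (rule Ck_on_SucE) blast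

lemma Ck_on_subset: "Ck_on k S f \<Longrightarrow> T \<subseteq> S \<Longrightarrow> Ck_on k T f"
proof (induction k arbitrary: f)
  case 0
  then show ?case
    by (auto intro: continuous_on_subset)
next
  case (Suc k)
  from Suc.prems(1) obtain f' where "\<And>x. x \<in> S \<Longrightarrow> (f has_derivative f' x) (at x)" "\<And>v. Ck_on k S (\<lambda>x. f' x v)"
    by (rule Ck_on_SucE) blast
  with Suc.prems(2) show ?case
    by (intro Ck_on_SucI [of T f f'] Suc.IH) auto
qed

lemma smooth_on_subset: "smooth_on S f \<Longrightarrow> T \<subseteq> S \<Longrightarrow> smooth_on T f"
  by (auto simp: smooth_on_def intro: Ck_on_subset)

lemma bounded_bilinear_mult_euclidean:
  "bounded_bilinear ((*) :: 'a::{real_algebra_1, euclidean_space} \<Rightarrow> 'a \<Rightarrow> 'a)"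
  unfolding bilinear_conv_bounded_bilinear [symmetric] bilinear_def
  by (auto intro!: linearI simp: algebra_simps)

text \<open>The defining recursion uses only multiplication, subtraction and linear maps, so
  smoothness is read off from it directly.\<close>

lemma smooth_on_gdet:
  "smooth_on S (gdet :: ('m::nontriv, 'd::{finite, linorder}) gca \<Rightarrow> complex)"
proof -
  have lin: "bounded_linear (\<lambda>U :: ('m, 'd) gca. c * scalar_part U)" for c
    by (rule bounded_linear_compose [OF bounded_linear_mult_right bounded_linear_scalar_part])
  have "smooth_on S (\<lambda>U :: ('m, 'd) gca. det_iter U k)" for k
  proof (induction k)
    case (Suc k)
    show ?case
    proof (cases k)
      case (Suc j)
      then show ?thesis
        using Suc.IH unfolding Suc det_iter.simps(3)
        by (intro smooth_on_bilinear [OF bounded_bilinear_mult_euclidean] smooth_on_id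
            smooth_on_diff smooth_on_compose_linear [OF bounded_linear_compose [OF bounded_linear_cscale lin]])
    qed (simp add: smooth_on_id)
  qed (simp add: smooth_on_const)
  from smooth_on_compose_linear [OF lin this [of "det_size TYPE(('m, 'd) gca)"],
      of "(- 1) ^ (det_size TYPE(('m, 'd) gca) + 1) * (of_nat (det_size TYPE(('m, 'd) gca)) / of_nat (det_size TYPE(('m, 'd) gca)))"]
  show ?thesis
    unfolding gdet_def [abs_def] det_coeff_def by (simp add: mult.assoc)
qed

text \<open>
  The coefficient norm is not submultiplicative, so the exponential function of normed algebras does
  not apply to \<open>gca\<close>; its power series still converges, because multiplication is bounded.
\<close>

lemma ex_exp_curve:
  fixes X :: "'a::{real_algebra_1, euclidean_space}"
  obtains E :: "real \<Rightarrow> 'a" where "E 0 = 1" "\<And>t. (E has_vector_derivative X * E t) (at t)"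
    "smooth_on UNIV E"
proof -
  interpret mult: bounded_bilinear "(*) :: 'a \<Rightarrow> 'a \<Rightarrow> 'a"
    by (rule bounded_bilinear_mult_euclidean)
  obtain K where K: "K \<ge> 0" "\<And>a b :: 'a. norm (a * b) \<le> norm a * norm b * K"
    using mult.nonneg_bounded by blast
  have norm_pow: "norm (X ^ n) \<le> norm (1 :: 'a) * (norm X * K) ^ n" for n
  proof (induction n)
    case (Suc n)
    have "norm (X ^ Suc n) \<le> norm X * norm (X ^ n) * K"
      using K(2) [of X "X ^ n"] by simp
    also have "\<dots> \<le> norm X * (norm (1 :: 'a) * (norm X * K) ^ n) * K"
      using K(1) Suc by (intro mult_right_mono mult_left_mono) auto
    finally show ?case
      by (simp add: mult_ac)
  qed simp
  define a where "a t n = (t ^ n / fact n) *\<^sub>R X ^ n" for t :: real and n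
  have "norm (a t n) \<le> norm (1 :: 'a) * (inverse (fact n) * (\<bar>t\<bar> * (norm X * K)) ^ n)"
    if "n \<ge> 0" for t n
  proof -
    have "norm (a t n) = \<bar>t\<bar> ^ n / fact n * norm (X ^ n)"
      by (simp add: a_def power_abs)
    also have "\<dots> \<le> \<bar>t\<bar> ^ n / fact n * (norm (1 :: 'a) * (norm X * K) ^ n)"
      by (intro mult_left_mono norm_pow) simp
    finally show ?thesis
      by (simp add: power_mult_distrib field_simps)
  qed
  then have summable_a: "summable (a t)" for t
    by (rule summable_comparison_test' [OF summable_mult [OF summable_exp]])
  define E where "E t = (\<Sum>n. a t n)" for t
  have E_sums: "a t sums E t" for t
    unfolding E_def by (rule summable_sums [OF summable_a])
  have E0: "E 0 = 1"
  proof -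
    have "a 0 = (\<lambda>n. if n = 0 then 1 else 0)"
      by (auto simp: a_def fun_eq_iff)
    then show ?thesis
      using E_sums [of 0] sums_unique2 sums_single [of 0 "\<lambda>_. 1 :: 'a"] by fastforce
  qed
  have deriv: "(E has_vector_derivative X * E t) (at t)" for t
  proof -
    \<comment> \<open>Each coordinate of \<open>E\<close> is a real power series with these
      coefficients, which allows termwise differentiation.\<close>
    define c where "c b n = (X ^ n \<bullet> b) / fact n" for b n
    have c_sums: "(\<lambda>n. c b n * s ^ n) sums (E s \<bullet> b)" for b s
      using bounded_linear.sums [OF bounded_linear_inner_left E_sums, of s b]
      by (simp add: a_def c_def mult.commute)
    have "((\<lambda>s. E s \<bullet> b) has_vector_derivative (X * E t) \<bullet> b) (at t)" for b
    proof -
      have "((\<lambda>s. \<Sum>n. c b n * s ^ n) has_real_derivative (\<Sum>n. diffs (c b) n * t ^ n)) (at t)"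
        by (rule termdiffs_strong_converges_everywhere) (rule sums_summable [OF c_sums])
      moreover have "(\<lambda>s. \<Sum>n. c b n * s ^ n) = (\<lambda>s. E s \<bullet> b)"
        using sums_unique [OF c_sums] by (simp add: fun_eq_iff)
      moreover have "(\<Sum>n. diffs (c b) n * t ^ n) = (X * E t) \<bullet> b"
      proof (rule sums_unique [symmetric])
        have "(\<lambda>n. (X * a t n) \<bullet> b) sums ((X * E t) \<bullet> b)"
          by (intro bounded_linear.sums [OF bounded_linear_inner_left]
              bounded_linear.sums [OF mult.bounded_linear_right] E_sums)
        moreover have "(X * a t n) \<bullet> b = diffs (c b) n * t ^ n" for n
          by (simp add: a_def c_def diffs_def field_simps del: of_nat_Suc)
        ultimately show "(\<lambda>n. diffs (c b) n * t ^ n) sums ((X * E t) \<bullet> b)"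
          by simp
      qed
      ultimately show ?thesis
        by (simp add: has_real_derivative_iff_has_vector_derivative)
    qed
    then have "((\<lambda>s. \<Sum>b\<in>Basis. (E s \<bullet> b) *\<^sub>R b) has_vector_derivative
        (\<Sum>b\<in>Basis. ((X * E t) \<bullet> b) *\<^sub>R b)) (at t)"
      by (intro has_vector_derivative_sum
          bounded_linear.has_vector_derivative [OF bounded_linear_scaleR_left])
    then show ?thesis
      by (simp add: euclidean_representation)
  qed
  \<comment> \<open>The differential equation expresses the derivative linearly through
    \<open>E\<close>, so each order of smoothness gives the next.\<close>
  have "Ck_on k UNIV E" for k
  proof (induction k)
    case 0
    show ?case
      using deriv by (auto intro!: continuous_at_imp_continuous_on has_vector_derivative_continuous)
  next
    case (Suc k)
    have "Ck_on k UNIV (\<lambda>t. v *\<^sub>R (X * E t))" for v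
      by (rule Ck_on_compose_linear [OF bounded_linear_compose [OF bounded_linear_scaleR_right
            mult.bounded_linear_right] Suc])
    then show ?case
      using deriv by (intro Ck_on_SucI [of UNIV E "\<lambda>t v. v *\<^sub>R (X * E t)"]) (simp_all add: has_vector_derivative_def)
  qed
  then show thesis
    using that E0 deriv by (auto simp: smooth_on_def)
qed

section \<open>The Lie group and its Lie algebra\<close>

lemma det_size_pos: "det_size T > 0"
  by (simp add: det_size_def)

lemma has_vector_derivative_prod_list_at_0:
  "((\<lambda>t. \<Prod>e\<leftarrow>es. 1 + of_real t * e) has_vector_derivative sum_list es) (at 0)"
  for es :: "complex list"
proof (induction es)
  case (Cons e es)
  have one: "(\<Prod>e\<leftarrow>es. 1 + of_real 0 * e) = 1"
    by (induction es) simp_all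
  have "((\<lambda>t. 1 + of_real t * e) has_vector_derivative e) (at 0)"
    by (auto intro!: derivative_eq_intros simp: has_vector_derivative_def scaleR_conv_of_real)
  from has_vector_derivative_mult [OF this Cons.IH] show ?case
    by (simp add: one [simplified] add.commute)
qed simp

text \<open>Differentiability being given, the derivative is determined along the line
  \<open>1 + t *\<^sub>R V\<close>, where \<open>gdet\<close> is a polynomial in t whose linear
  coefficient is the trace.\<close>

lemma gdet_derivative_at_one:
  fixes V :: "('m::nontriv, 'd::{finite, linorder}) gca"
  assumes D: "(gdet has_derivative D) (at 1)"
  shows "D V = of_nat (det_size TYPE(('m, 'd) gca)) * scalar_part V"
proof -
  obtain es where tr: "of_nat (det_size TYPE(('m, 'd) gca)) * scalar_part V = sum_list es"
    and prod: "\<And>t. gdet (1 + cscale t V) = (\<Prod>e\<leftarrow>es. 1 + t * e)"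
    by (rule gdet_one_plus [of V]) blast
  have "((\<lambda>t. 1 + t *\<^sub>R V) has_derivative (\<lambda>t. t *\<^sub>R V)) (at 0)"
    by (auto intro!: derivative_eq_intros)
  from diff_chain_at [OF this, of gdet D] D
  have "((\<lambda>t. gdet (1 + t *\<^sub>R V)) has_derivative (\<lambda>t. D (t *\<^sub>R V))) (at 0)"
    by (simp add: o_def)
  then have "((\<lambda>t. gdet (1 + t *\<^sub>R V)) has_vector_derivative D V) (at 0)"
    using linear_scale [OF has_derivative_linear [OF D]] by (simp add: has_vector_derivative_def)
  moreover have "gdet (1 + t *\<^sub>R V) = (\<Prod>e\<leftarrow>es. 1 + of_real t * e)" for t
    using prod [of "of_real t"] by (simp add: cscale_algebra(7))
  ultimately have "((\<lambda>t. \<Prod>e\<leftarrow>es. 1 + of_real t * e) has_vector_derivative D V) (at 0)"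
    by simp
  then show ?thesis
    unfolding tr by (rule vector_derivative_unique_at) (rule has_vector_derivative_prod_list_at_0)
qed

text \<open>Jacobi's formula, transported from the identity by writing \<open>gdet U\<close> as
  \<open>gdet x * gdet (y * U)\<close>.\<close>

lemma gdet_has_derivative:
  fixes x :: "('m::nontriv, 'd::{finite, linorder}) gca"
  assumes yx: "y * x = 1"
  shows "(gdet has_derivative
    (\<lambda>h. gdet x * (of_nat (det_size TYPE(('m, 'd) gca)) * scalar_part (y * h)))) (at x)"
proof -
  obtain D' where "\<And>x :: ('m, 'd) gca. x \<in> UNIV \<Longrightarrow> (gdet has_derivative D' x) (at x)"
    by (rule smooth_on_has_derivative [OF smooth_on_gdet]) blast
  then have D: "(gdet has_derivative D' (1 :: ('m, 'd) gca)) (at (y * x))"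
    unfolding yx by simp
  have mult: "((\<lambda>U. y * U) has_derivative (\<lambda>h. y * h)) (at x)"
    by (rule bounded_linear_imp_has_derivative)
       (rule bounded_bilinear.bounded_linear_right [OF bounded_bilinear_mult_euclidean])
  have eq: "gdet U = gdet x * gdet (y * U)" for U
    using gca_left_inverse_imp_right_inverse [OF yx] by (simp flip: gdet_mult mult.assoc)
  have "((\<lambda>U. gdet x * gdet (y * U)) has_derivative (\<lambda>h. gdet x * D' 1 (y * h))) (at x)"
    using diff_chain_at [OF mult D] by (intro has_derivative_mult_right) (simp add: o_def)
  then show ?thesis
    unfolding eq [symmetric] using D by (simp add: gdet_derivative_at_one yx)
qed

lemma gdet_vector_derivative:
  fixes \<gamma> :: "real \<Rightarrow> ('m::nontriv, 'd::{finite, linorder}) gca"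
  assumes "(\<gamma> has_vector_derivative X) (at t)" and "y * \<gamma> t = 1"
  shows "((\<lambda>t. gdet (\<gamma> t)) has_vector_derivative
    gdet (\<gamma> t) * (of_nat (det_size TYPE(('m, 'd) gca)) * scalar_part (y * X))) (at t)"
  using diff_chain_at [OF assms(1) [unfolded has_vector_derivative_def] gdet_has_derivative [OF assms(2)]]
  by (simp add: has_vector_derivative_def o_def)

lemma hconj_mult_vector_derivative:
  fixes \<gamma> :: "real \<Rightarrow> ('m::nontriv, 'd::{finite, linorder}) gca"
  assumes "(\<gamma> has_vector_derivative X) (at t)"
  shows "((\<lambda>t. hconj (\<gamma> t) * \<gamma> t) has_vector_derivative (hconj (\<gamma> t) * X + hconj X * \<gamma> t)) (at t)"
  by (intro bounded_bilinear.has_vector_derivative [OF bounded_bilinear_mult_euclidean] assms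
      bounded_linear.has_vector_derivative [OF bounded_linear_hconj])

lemma SU_gca_unit:
  assumes "U \<in> SU_gca"
  shows "hconj U * U = 1" "U * hconj U = 1" "gdet U = 1"
  using assms gca_left_inverse_imp_right_inverse [of "hconj U" U] by (simp_all add: SU_gca_def)

lemma one_in_SU_gca: "1 \<in> SU_gca"
  by (simp add: SU_gca_def hconj_one gdet_one)

lemma SU_gca_mult:
  assumes "U \<in> SU_gca" "V \<in> SU_gca"
  shows "U * V \<in> SU_gca"
proof -
  have "hconj (U * V) * (U * V) = hconj V * (hconj U * U) * V"
    by (simp only: hconj_mult mult.assoc)
  then show ?thesis
    using assms by (simp add: SU_gca_def gdet_mult)
qed

lemma hconj_in_SU_gca:
  assumes "U \<in> SU_gca"
  shows "hconj U \<in> SU_gca"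
  using SU_gca_unit [OF assms] by (simp add: SU_gca_def hconj_hconj gdet_hconj)

lemma hconj_imaginary: "hconj (cscale \<i> 1) = - cscale \<i> 1"
  by (rule gca_eqI) (simp add: hconj_cscale hconj_one)

lemma scalar_part_hermitian: "hconj S = S \<Longrightarrow> Im (scalar_part S) = 0"
  using scalar_part_hconj [of S] by (simp add: complex_eq_iff)

text \<open>A Hermitian element has real scalar part, so the imaginary part of the scalar part
  isolates \<open>r\<close>.\<close>

lemma hermitian_plus_imaginary_eq_0:
  fixes S :: "('m::nontriv, 'd::{finite, linorder}) gca"
  assumes "hconj S = S" "S + r *\<^sub>R cscale \<i> 1 = 0"
  shows "S = 0" "r = 0"
proof -
  have "Im (scalar_part (S + r *\<^sub>R cscale \<i> 1)) = r"
    using scalar_part_hermitian [OF assms(1)] by simp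
  with assms(2) show "r = 0" by simp
  with assms(2) show "S = 0" by simp
qed

text \<open>The target subspace of the equation defining the group. The sum is direct, so one
  equation in it carries both conditions.\<close>

definition herm_plus_imag :: "('m::nontriv, 'd::{finite, linorder}) gca set" where
  "herm_plus_imag = {S + r *\<^sub>R cscale \<i> 1 |S r. hconj S = S}"

lemma subspace_herm_plus_imag: "subspace herm_plus_imag"
proof (rule subspaceI)
  show "0 \<in> herm_plus_imag"
    unfolding herm_plus_imag_def by (rule CollectI, rule exI [of _ 0], rule exI [of _ 0]) (simp add: hconj_zero)
next
  fix x y :: "('a, 'b) gca" and c :: real
  assume "x \<in> herm_plus_imag"
  then obtain S r where S: "hconj S = S" "x = S + r *\<^sub>R cscale \<i> 1"
    by (auto simp: herm_plus_imag_def)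
  have "c *\<^sub>R x = c *\<^sub>R S + (c * r) *\<^sub>R cscale \<i> 1"
    by (simp add: S(2) scaleR_add_right)
  then show "c *\<^sub>R x \<in> herm_plus_imag"
    using S(1) unfolding herm_plus_imag_def by (blast intro: hconj_scaleR [of c S, unfolded S(1)])
  assume "y \<in> herm_plus_imag"
  then obtain S' r' where S': "hconj S' = S'" "y = S' + r' *\<^sub>R cscale \<i> 1"
    by (auto simp: herm_plus_imag_def)
  have "x + y = (S + S') + (r + r') *\<^sub>R cscale \<i> 1"
    by (simp add: S(2) S'(2) scaleR_add_left)
  then show "x + y \<in> herm_plus_imag"
    unfolding herm_plus_imag_def using hconj_add [of S S', unfolded S(1) S'(1)] by blast
qed

text \<open>
  On unitary elements $|{\rm Det}| = 1$, so that near the group ${\rm Det}(U) = 1$ is the single real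
  equation ${\rm Im}\,{\rm Det}(U) = 0$; it is added to $\overline{U}U = e$ along the direction $i e$,
  which is complementary to the Hermitian elements.
\<close>

definition SU_equation :: "('m::nontriv, 'd::{finite, linorder}) gca \<Rightarrow> ('m, 'd) gca" where
  "SU_equation x = (hconj x * x - 1) + Im (gdet x) *\<^sub>R cscale \<i> 1"

lemma hermitian_hconj_mult: "hconj (hconj x * x - 1) = hconj x * x - 1"
  by (simp add: hconj_diff hconj_mult hconj_hconj hconj_one)

text \<open>A unitary element with real determinant has determinant 1 or -1; the hypothesis excludes
  -1.\<close>

lemma SU_gca_iff_equation:
  assumes "0 < Re (gdet x)"
  shows "x \<in> SU_gca \<longleftrightarrow> SU_equation x = 0"
proof
  assume "x \<in> SU_gca"
  then show "SU_equation x = 0"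
    by (simp add: SU_gca_def SU_equation_def)
next
  assume "SU_equation x = 0"
  from hermitian_plus_imaginary_eq_0 [OF hermitian_hconj_mult this [unfolded SU_equation_def]]
  have x: "hconj x * x = 1" "Im (gdet x) = 0"
    by simp_all
  have "cnj (gdet x) * gdet x = 1"
    using x(1) gdet_mult [of "hconj x" x] by (simp add: gdet_hconj gdet_one)
  then have "(Re (gdet x))\<^sup>2 = 1"
    using x(2) by (simp add: complex_eq_iff power2_eq_square)
  then have "Re (gdet x) = 1"
    using assms by (simp add: power2_eq_1_iff)
  with x show "x \<in> SU_gca"
    by (simp add: SU_gca_def complex_eq_iff)
qed

lemma smooth_on_SU_equation:
  "smooth_on W (SU_equation :: ('m::nontriv, 'd::{finite, linorder}) gca \<Rightarrow> _)"
  unfolding SU_equation_def [abs_def]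
  by (rule smooth_on_add, rule smooth_on_diff, rule smooth_on_bilinear [OF bounded_bilinear_mult_euclidean],
      rule smooth_on_compose_linear [OF bounded_linear_hconj], rule smooth_on_id, rule smooth_on_id,
      rule smooth_on_const,
      rule smooth_on_compose_linear [OF bounded_linear_compose [OF bounded_linear_scaleR_left bounded_linear_Im]],
      rule smooth_on_gdet)

text \<open>With \<open>h = x * k\<close> the derivative takes its form at the identity, so
  surjectivity at \<open>x\<close> reduces to solving for \<open>k\<close>.\<close>

lemma SU_equation_derivative:
  fixes x :: "('m::nontriv, 'd::{finite, linorder}) gca"
  assumes "x \<in> SU_gca"
  shows "\<exists>F'. (SU_equation has_derivative F') (at x) \<and> range F' = herm_plus_imag"
proof -
  let ?N = "det_size TYPE(('m, 'd) gca)"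
  note x = SU_gca_unit [OF assms]
  define F' where "F' h = hconj x * h + hconj h * x
      + Im (of_nat ?N * scalar_part (hconj x * h)) *\<^sub>R cscale \<i> (1 :: ('m, 'd) gca)" for h
  have hc: "(hconj has_derivative hconj) (at x)"
    by (rule bounded_linear_imp_has_derivative [OF bounded_linear_hconj])
  have d: "(gdet has_derivative (\<lambda>h. of_nat ?N * scalar_part (hconj x * h))) (at x)"
    using gdet_has_derivative [OF x(1)] by (simp add: x(3))
  have "((\<lambda>y. (hconj y * y - 1) + Im (gdet y) *\<^sub>R cscale \<i> (1 :: ('m, 'd) gca)) has_derivative
      (\<lambda>h. (hconj x * h + hconj h * x - 0)
        + Im (of_nat ?N * scalar_part (hconj x * h)) *\<^sub>R cscale \<i> 1)) (at x)"
    by (intro has_derivative_add has_derivative_diff has_derivative_const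
        bounded_bilinear.FDERIV [OF bounded_bilinear_mult_euclidean] hc has_derivative_ident
        has_derivative_scaleR_left bounded_linear.has_derivative [OF bounded_linear_Im d])
  then have "(SU_equation has_derivative F') (at x)"
    by (simp add: SU_equation_def [abs_def] F'_def [abs_def])
  moreover have "range F' = herm_plus_imag"
  proof (intro equalityI subsetI)
    fix Y assume "Y \<in> range F'"
    then obtain h where h: "Y = F' h" by blast
    have "hconj (hconj x * h + hconj h * x) = hconj x * h + hconj h * x"
      by (simp add: hconj_add hconj_mult hconj_hconj)
    with h show "Y \<in> herm_plus_imag"
      unfolding herm_plus_imag_def F'_def by blast
  next
    fix Y :: "('m, 'd) gca" assume "Y \<in> herm_plus_imag"
    then obtain S r where S: "hconj S = S" and Y: "Y = S + r *\<^sub>R cscale \<i> 1"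
      by (auto simp: herm_plus_imag_def)
    \<comment> \<open>Half of \<open>S\<close> produces the Hermitian part. The imaginary scalar
      cancels in \<open>k + hconj k\<close> and gives \<open>r\<close> after multiplication by
      \<open>?N\<close>.\<close>
    define k where "k = (1 / 2) *\<^sub>R S + (r / real ?N) *\<^sub>R cscale \<i> 1"
    have hk: "k + hconj k = S"
    proof -
      have "k + hconj k = (1 / 2) *\<^sub>R S + (1 / 2) *\<^sub>R S"
        by (simp add: k_def hconj_add hconj_scaleR hconj_imaginary S)
      then show ?thesis
        by (simp flip: scaleR_add_left)
    qed
    have "Im (of_nat ?N * scalar_part k) = r"
      using det_size_pos [of "TYPE(('m, 'd) gca)"] scalar_part_hermitian [OF S] by (simp add: k_def)
    moreover have "hconj x * (x * k) = k" "hconj (x * k) * x = hconj k"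
      using x by (simp_all add: hconj_mult mult.assoc) (simp flip: mult.assoc)
    ultimately have "F' (x * k) = Y"
      by (simp add: F'_def Y hk)
    then show "Y \<in> range F'" by blast
  qed
  ultimately show ?thesis by blast
qed

lemma smooth_submanifold_SU_gca:
  "smooth_submanifold (DIM(('m, 'd) gca) - dim (herm_plus_imag :: ('m, 'd) gca set))
    (SU_gca :: ('m::nontriv, 'd::{finite, linorder}) gca set)"
  unfolding smooth_submanifold_def
proof
  fix p :: "('m, 'd) gca" assume p: "p \<in> SU_gca"
  let ?W = "{x :: ('m, 'd) gca. 0 < Re (gdet x)}"
  have "continuous_on UNIV (gdet :: ('m, 'd) gca \<Rightarrow> complex)"
    using smooth_on_gdet [of UNIV, unfolded smooth_on_def, rule_format, of 0] by simp
  then have W: "open ?W"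
    by (intro open_Collect_less continuous_on_Re continuous_on_const)
  have pW: "p \<in> ?W"
    using SU_gca_unit(3) [OF p] by simp
  \<comment> \<open>The subtraction of natural numbers does not truncate, the dimension of a
    subspace being bounded by that of the space.\<close>
  have dim: "dim (herm_plus_imag :: ('m, 'd) gca set)
      + (DIM(('m, 'd) gca) - dim (herm_plus_imag :: ('m, 'd) gca set)) = DIM(('m, 'd) gca)"
    using dim_subset_UNIV [of "herm_plus_imag :: ('m, 'd) gca set"] by simp
  have img: "SU_equation ` ?W \<subseteq> herm_plus_imag"
    using hermitian_hconj_mult by (auto simp: SU_equation_def herm_plus_imag_def)
  have zero: "SU_gca \<inter> ?W = {x \<in> ?W. SU_equation x = 0}"
    using SU_gca_iff_equation by blast
  show "\<exists>W T (F :: ('m, 'd) gca \<Rightarrow> ('m, 'd) gca).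
     open W \<and> p \<in> W \<and> subspace T
     \<and> dim T + (DIM(('m, 'd) gca) - dim (herm_plus_imag :: ('m, 'd) gca set)) = DIM(('m, 'd) gca)
     \<and> smooth_on W F \<and> F ` W \<subseteq> T \<and> SU_gca \<inter> W = {x \<in> W. F x = 0}
     \<and> (\<forall>x\<in>SU_gca \<inter> W. \<exists>F'. (F has_derivative F') (at x) \<and> range F' = T)"
    by (rule exI [of _ ?W], rule exI [of _ herm_plus_imag], rule exI [of _ SU_equation],
        intro conjI W pW subspace_herm_plus_imag dim smooth_on_SU_equation img zero ballI SU_equation_derivative)
      (rule IntD1)
qed

lemma Lie_group_SU_gca: "Lie_group (SU_gca :: ('m::nontriv, 'd::{finite, linorder}) gca set)"
  unfolding Lie_group_def
proof (intro conjI ballI)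
  fix x :: "('m, 'd) gca" assume "x \<in> SU_gca"
  then show "\<exists>y\<in>SU_gca. x * y = 1 \<and> y * x = 1"
    using SU_gca_unit hconj_in_SU_gca by blast
next
  show "\<exists>n. smooth_submanifold n (SU_gca :: ('m, 'd) gca set)"
    by (rule exI, rule smooth_submanifold_SU_gca)
qed (rule one_in_SU_gca, rule SU_gca_mult)

lemma Lie_algebra_su_gca: "Lie_algebra (su_gca :: ('m::nontriv, 'd::{finite, linorder}) gca set) commutator"
proof -
  have "subspace (su_gca :: ('m, 'd) gca set)"
    by (rule subspaceI) (simp_all add: su_gca_def hconj_zero hconj_add hconj_scaleR)
  moreover have "commutator x y \<in> su_gca" if "x \<in> su_gca" "y \<in> su_gca" for x y :: "('m, 'd) gca"
    using that scalar_part_mult_commute [of x y]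
    by (simp add: su_gca_def commutator_def hconj_diff hconj_mult)
  ultimately show ?thesis
    by (simp add: Lie_algebra_def commutator_def algebra_simps)
qed

section \<open>The tangent space at the identity\<close>

lemma constant_curve_derivative:
  fixes f :: "real \<Rightarrow> 'a::real_normed_vector"
  assumes "(f has_vector_derivative D) (at 0)" "\<epsilon> > 0" "\<And>t. t \<in> {- \<epsilon> <..< \<epsilon>} \<Longrightarrow> f t = c"
  shows "D = 0"
proof -
  have "((\<lambda>_. c) has_vector_derivative 0) (at (0 :: real))"
    by (rule has_vector_derivative_const)
  then have "(f has_vector_derivative 0) (at 0)"
    by (rule has_vector_derivative_transform_within_open [where S = "{- \<epsilon> <..< \<epsilon>}"]) (use assms in auto)
  with assms(1) show ?thesis
    by (rule vector_derivative_unique_at)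
qed

lemma constant_if_vector_derivative_0:
  fixes f :: "real \<Rightarrow> 'a::banach"
  assumes "\<And>t. (f has_vector_derivative 0) (at t)"
  shows "f t = f 0"
proof -
  obtain c where "\<And>x. x \<in> UNIV \<Longrightarrow> f x = c"
    by (rule has_vector_derivative_zero_constant [of UNIV f]) (use assms in auto)
  then show ?thesis by simp
qed

lemma tangent_space_SU_gca: "tangent_space SU_gca 1 = (su_gca :: ('m::nontriv, 'd::{finite, linorder}) gca set)"
proof (intro equalityI subsetI)
  let ?N = "det_size TYPE(('m, 'd) gca)"
  fix X :: "('m, 'd) gca" assume "X \<in> tangent_space SU_gca 1"
  then obtain \<gamma> \<epsilon> where \<epsilon>: "\<epsilon> > 0" and \<gamma>: "\<gamma> ` {- \<epsilon> <..< \<epsilon>} \<subseteq> SU_gca" "\<gamma> 0 = 1"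
    "(\<gamma> has_vector_derivative X) (at 0)"
    by (auto simp: tangent_space_def)
  have mem: "\<gamma> t \<in> SU_gca" if "t \<in> {- \<epsilon> <..< \<epsilon>}" for t
    using \<gamma>(1) that by blast
  have "hconj (\<gamma> 0) * X + hconj X * \<gamma> 0 = 0"
    by (rule constant_curve_derivative [OF hconj_mult_vector_derivative [OF \<gamma>(3)] \<epsilon>])
      (rule SU_gca_unit(1) [OF mem])
  moreover have "1 * \<gamma> 0 = 1"
    using \<gamma>(2) by simp
  then have "gdet (\<gamma> 0) * (of_nat ?N * scalar_part (1 * X)) = 0"
    by (rule constant_curve_derivative [OF gdet_vector_derivative [OF \<gamma>(3)] \<epsilon>])
      (rule SU_gca_unit(3) [OF mem])
  ultimately show "X \<in> su_gca"
    using \<gamma>(2) det_size_pos [of "TYPE(('m, 'd) gca)"]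
    by (simp add: su_gca_def hconj_one gdet_one eq_neg_iff_add_eq_0 add.commute)
next
  fix X :: "('m, 'd) gca" assume X: "X \<in> su_gca"
  obtain E :: "real \<Rightarrow> ('m, 'd) gca" where E: "E 0 = 1"
    "\<And>t. (E has_vector_derivative X * E t) (at t)" "smooth_on UNIV E"
    by (rule ex_exp_curve [of X]) blast
  have unitary: "hconj (E t) * E t = 1" for t
  proof -
    \<comment> \<open>The derivative of \<open>hconj (E t) * E t\<close> contains the factor
      \<open>X + hconj X\<close>, which is zero.\<close>
    have "hconj (E t) * (X * E t) + hconj (X * E t) * E t = hconj (E t) * (X + hconj X) * E t" for t
      by (simp add: hconj_mult algebra_simps)
    then have "((\<lambda>t. hconj (E t) * E t) has_vector_derivative 0) (at t)" for t
      using hconj_mult_vector_derivative [OF E(2)] X by (simp add: su_gca_def)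
    from constant_if_vector_derivative_0 [OF this, of t] show ?thesis
      by (simp add: E(1) hconj_one)
  qed
  have det: "gdet (E t) = 1" for t
  proof -
    have "scalar_part (hconj (E t) * (X * E t)) = 0" for t
    proof -
      \<comment> \<open>Cyclicity of the scalar part, together with unitarity, reduces the
        logarithmic derivative of the determinant to the scalar part of \<open>X\<close>.\<close>
      have "scalar_part (hconj (E t) * (X * E t)) = scalar_part (X * (E t * hconj (E t)))"
        by (subst scalar_part_mult_commute) (simp add: mult.assoc)
      then show ?thesis
        using X gca_left_inverse_imp_right_inverse [OF unitary] by (simp add: su_gca_def)
    qed
    then have "((\<lambda>t. gdet (E t)) has_vector_derivative 0) (at t)" for t
      using gdet_vector_derivative [OF E(2) unitary, of t] by simp
    from constant_if_vector_derivative_0 [OF this, of t] show ?thesis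
      by (simp add: E(1) gdet_one)
  qed
  have "E ` {- 1 <..< 1} \<subseteq> SU_gca" "smooth_on {- 1 <..< 1} E" "(E has_vector_derivative X) (at 0)"
    using unitary det smooth_on_subset [OF E(3)] E(2) [of 0] by (auto simp: SU_gca_def E(1))
  then show "X \<in> tangent_space SU_gca 1"
    unfolding tangent_space_def using E(1) by (intro CollectI exI [of _ E] exI [of _ 1]) simp
qed

lemma vector_field_bracket_left_invariant:
  fixes X Y :: "'a::{real_algebra_1, euclidean_space}"
  shows "vector_field_bracket (\<lambda>U. U * X) (\<lambda>U. U * Y) 1 = commutator X Y"
proof -
  have "frechet_derivative (\<lambda>U. U * Z) (at 1) = (\<lambda>h. h * Z)" for Z :: 'a
    by (rule frechet_derivative_at [symmetric], rule bounded_linear_imp_has_derivative)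
       (rule bounded_bilinear.bounded_linear_left [OF bounded_bilinear_mult_euclidean])
  then show ?thesis
    by (simp add: vector_field_bracket_def commutator_def)
qed

lemma su_gca_isomorphic_su_mat:
  assumes even: "even CARD('d)"
  shows "Lie_isomorphic_mat (su_gca :: ('m::nontriv, 'd::{finite, linorder}) gca set)
    (su_mat (CARD('m) ^ (CARD('d) div 2)))"
proof -
  let ?N = "CARD('m) ^ (CARD('d) div 2)"
  have N: "det_size TYPE(('m, 'd) gca) = ?N"
    using even by (simp add: det_size_def)
  obtain rep :: "('m, 'd) gca \<Rightarrow> complex mat" where
    carrier: "\<And>U. rep U \<in> carrier_mat ?N ?N"
    and rep: "\<And>U V. rep (U + V) = rep U + rep V" "\<And>U V. rep (U - V) = rep U - rep V"
      "\<And>c U. rep (cscale c U) = c \<cdot>\<^sub>m rep U" "\<And>U V. rep (U * V) = rep U * rep V"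
    and minus: "\<And>U. rep (- U) = - rep U"
    and adj: "\<And>U. rep (hconj U) = mat_adjoint (rep U)"
    and tr: "\<And>U. mat_trace (rep U) = of_nat ?N * scalar_part U"
    and bij: "inj rep" "range rep = carrier_mat ?N ?N"
    by (rule ex_gca_rep [where 'm = 'm and 'd = 'd, unfolded N]) (use even in blast)
  \<comment> \<open>Injectivity reflects the adjoint condition, and the nonzero factor in the trace
    formula reflects tracelessness, so the equivalence holds in both directions.\<close>
  have mem: "rep U \<in> su_mat ?N \<longleftrightarrow> U \<in> su_gca" for U
  proof -
    have "(\<Sum>i<?N. rep U $$ (i, i)) = of_nat ?N * scalar_part U"
      using tr [of U] carrier [of U] by (simp add: mat_trace_def)
    then show ?thesis
      using carrier [of U] bij(1) by (simp add: su_mat_def su_gca_def inj_eq flip: adj minus)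
  qed
  have "bij_betw rep su_gca (su_mat ?N)"
    unfolding bij_betw_def
  proof
    show "inj_on rep su_gca"
      using bij(1) by (rule inj_on_subset) simp
    have "A \<in> rep ` su_gca" if A: "A \<in> su_mat ?N" for A
    proof -
      have "A \<in> range rep"
        using A unfolding bij(2) by (simp add: su_mat_def)
      with A mem show ?thesis by blast
    qed
    then show "rep ` su_gca = su_mat ?N"
      using mem by blast
  qed
  moreover have "rep (r *\<^sub>R X) = of_real r \<cdot>\<^sub>m rep X" for r X
    by (simp add: rep flip: cscale_algebra(7))
  ultimately show ?thesis
    unfolding Lie_isomorphic_mat_def
    by (intro exI [of _ rep]) (simp add: rep commutator_def)
qed

theorem corollary8p2:
  shows "Lie_group (SU_gca :: ('m::nontriv, 'd::{finite, linorder}) gca set) \<and>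
    Lie_algebra (su_gca :: ('m, 'd) gca set) commutator \<and>
    Lie_algebra_of (su_gca :: ('m, 'd) gca set) commutator SU_gca \<and>
    (even CARD('d) \<longrightarrow>
       Lie_isomorphic_mat (su_gca :: ('m, 'd) gca set) (su_mat (CARD('m) ^ (CARD('d) div 2))))"
proof (intro conjI impI)
  show "Lie_algebra_of (su_gca :: ('m, 'd) gca set) commutator SU_gca"
    unfolding Lie_algebra_of_def tangent_space_SU_gca vector_field_bracket_left_invariant by blast
qed (rule Lie_group_SU_gca, rule Lie_algebra_su_gca, rule su_gca_isomorphic_su_mat)

end
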